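(* Let $p\in[1,\infty)$ and let $(\epsilon_n)$ be a sequence of positive numbers with $\epsilon_n\to0$ and $n\epsilon_n^2\to\infty$. Assume that the prior satisfies $\Pi_n(\mathcal K_n)\ge e^{-n\epsilon_n^2}$ for all large enough $n$, where $$\mathcal K_n=\Big\{q\in\mathcal F:\int\log\frac{p_0}{q}\,dP_0\le\epsilon_n^2,\ \int\Big(\log\frac{p_0}{q}\Big)^2dP_0\le\epsilon_n^2\Big\}.$$ Furthermore, assume that there exists a constant $K$ such that $M_{2p}(P_0)\le K$ and $$\Pi_n\big(M_{2p}(P)>K\mid X_1,\ldots,X_n\big)\to0\quad\text{in probability.}$$ Then, for some constant $K'>0$, $$\Pi_n\big(|M_p(P)-M_p(P_0)|>K'\epsilon_n\mid X_1,\ldots,X_n\big)\to0\quad\text{in probability.}$$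
   Context: Setting: $X_1,X_2,\ldots$ are i.i.d. real random variables from a true distribution $P_0$ having a Lebesgue density $p_0$ on $\mathbb R$. $\mathcal F$ is a collection of probability densities on $\mathbb R$ equipped with the weak topology, and $\Pi=\Pi_n$ is a prior (a probability measure on $\mathcal F$), which may depend on the sample size $n$. For a measurable $A\subset\mathcal F$ the posterior probability is $$\Pi_n(A\mid X_1,\ldots,X_n)=\frac{\int_A\prod_{i=1}^n q(X_i)/p_0(X_i)\,d\Pi_n(q)}{\int_{\mathcal F}\prod_{i=1}^n q(X_i)/p_0(X_i)\,d\Pi_n(q)}.$$ A density is identified with its probability measure, and $P$ inside $\Pi_n(\cdot\mid X_1,\ldots,X_n)$ denotes the random probability measure whose density is drawn from the posterior. Convergence in probability is with respect to the true distribution $P_0$ of the data, as $n\to\infty$. Constants do not depend on $n$. Notation: $M_r(P)=\int|x|^r\,dP(x)$. *)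

theory Defs
  imports "HOL-Probability.Probability"
begin

definition is_density :: "(real \<Rightarrow> real) \<Rightarrow> bool" where
  "is_density q \<longleftrightarrow>
     q \<in> borel_measurable borel \<and> (\<forall>x. 0 \<le> q x) \<and> (\<integral>\<^sup>+ x. ennreal (q x) \<partial>lborel) = 1"

definition law_of :: "(real \<Rightarrow> real) \<Rightarrow> real measure" where
  "law_of q = density lborel (\<lambda>x. ennreal (q x))"

text \<open>
  The weak topology on a family of densities: the coarsest topology on \<open>F\<close> making
  \<open>q \<mapsto> \<integral> f d(law_of q)\<close> continuous for every bounded continuous \<open>f\<close>.
\<close>

definition weak_topology :: "(real \<Rightarrow> real) set \<Rightarrow> (real \<Rightarrow> real) topology" where
  "weak_topology F = topology_generated_by
     {{q \<in> F. (\<integral>x. f x \<partial>law_of q) \<in> U} | (f :: real \<Rightarrow> real) U. f \<in> bcontfun \<and> open U}"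

definition weak_borel :: "(real \<Rightarrow> real) set \<Rightarrow> (real \<Rightarrow> real) measure" where
  "weak_borel F = sigma F {U. openin (weak_topology F) U}"

text \<open>Moments take values in the extended reals, so that an infinite moment exceeds every bound.\<close>

definition abs_moment :: "real \<Rightarrow> real measure \<Rightarrow> ereal" where
  "abs_moment r P = enn2ereal (\<integral>\<^sup>+ x. ennreal (\<bar>x\<bar> powr r) \<partial>P)"

text \<open>
  \<open>log (a / b)\<close> with the convention \<open>log (a / 0) = \<infinity>\<close> for \<open>a > 0\<close>. Below it is only integrated
  against the law with density \<open>a\<close>, so that its value at \<open>a = 0\<close> is irrelevant.
\<close>

definition log_ratio :: "real \<Rightarrow> real \<Rightarrow> ereal" where
  "log_ratio a b = (if b = 0 then \<infinity> else ereal (ln (a / b)))"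

text \<open>
  The integral of an extended-real function as the difference of the integrals of its positive and
  negative parts (\<open>e2ennreal\<close> maps negative arguments to \<open>0\<close>). The Bochner integral would
  be \<open>0\<close> for a divergent integral, hence small, where the intended value is \<open>\<infinity>\<close>. The negative part
  of \<open>log (p0 / q)\<close> always has a finite integral, so that \<open>\<infinity> - \<infinity>\<close> does not arise in \<open>KL_nbhd\<close>.
\<close>

definition ext_integral :: "'a measure \<Rightarrow> ('a \<Rightarrow> ereal) \<Rightarrow> ereal" where
  "ext_integral M f =
     enn2ereal (\<integral>\<^sup>+ x. e2ennreal (f x) \<partial>M) - enn2ereal (\<integral>\<^sup>+ x. e2ennreal (- f x) \<partial>M)"

definition KL_nbhd :: "(real \<Rightarrow> real) set \<Rightarrow> (real \<Rightarrow> real) \<Rightarrow> real \<Rightarrow> (real \<Rightarrow> real) set" where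
  "KL_nbhd F p0 e = {q \<in> F.
     ext_integral (law_of p0) (\<lambda>x. log_ratio (p0 x) (q x)) \<le> ereal (e\<^sup>2) \<and>
     ext_integral (law_of p0) (\<lambda>x. (log_ratio (p0 x) (q x))\<^sup>2) \<le> ereal (e\<^sup>2)}"

text \<open>
  The posterior given the data \<open>x 1, \<dots>, x n\<close>. The quotient is taken in the extended nonnegative
  reals and then made real; where the denominator is \<open>0\<close> or \<open>\<infinity>\<close> the value is \<open>0\<close>.
\<close>

definition posterior ::
  "(real \<Rightarrow> real) measure \<Rightarrow> (real \<Rightarrow> real) \<Rightarrow> nat \<Rightarrow> (nat \<Rightarrow> real) \<Rightarrow> (real \<Rightarrow> real) set \<Rightarrow> real" where
  "posterior \<pi> p0 n x A = enn2real
     ((\<integral>\<^sup>+ q \<in> A. ennreal (\<Prod>i=1..n. q (x i) / p0 (x i)) \<partial>\<pi>) /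
      (\<integral>\<^sup>+ q. ennreal (\<Prod>i=1..n. q (x i) / p0 (x i)) \<partial>\<pi>))"

definition tendsto_in_prob :: "'a measure \<Rightarrow> (nat \<Rightarrow> 'a \<Rightarrow> real) \<Rightarrow> real \<Rightarrow> bool" where
  "tendsto_in_prob M Y c \<longleftrightarrow>
     (\<forall>\<delta>>0. (\<lambda>n. measure M {\<omega> \<in> space M. \<delta> < \<bar>Y n \<omega> - c\<bar>}) \<longlonglongrightarrow> 0)"

text \<open>
  A family \<open>F\<close> of densities in which every member represents its probability measure through a
  version of the density that is jointly measurable in \<open>(q, x)\<close>, for the weak Borel sets on \<open>F\<close>.
  This makes the integrals in the posterior well defined and random variables in the data. Weakly
  Borel sets do not separate densities of the same law, so \<open>F\<close> contains one version per law.
\<close>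

definition density_family :: "(real \<Rightarrow> real) set \<Rightarrow> bool" where
  "density_family F \<longleftrightarrow> (\<forall>q\<in>F. is_density q) \<and>
     (\<lambda>(q, x). q x) \<in> borel_measurable (weak_borel F \<Otimes>\<^sub>M borel)"

definition is_prior :: "(real \<Rightarrow> real) set \<Rightarrow> (real \<Rightarrow> real) measure \<Rightarrow> bool" where
  "is_prior F \<pi> \<longleftrightarrow> prob_space \<pi> \<and> sets \<pi> = sets (weak_borel F)"

end

theory Submission
  imports Defs
begin

text \<open>
  If \<open>P\<close> and \<open>P\<^sub>0\<close> have moments of order \<open>2p\<close> at most \<open>K\<close> and moments of order \<open>p\<close> at distance
  \<open>\<delta>\<close>, then by Cauchy--Schwarz their Hellinger affinity is at most \<open>\<rho> = exp (- \<delta>\<^sup>2 / 8K)\<close>. With a fixed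
  sign of the moment difference these constraints survive mixing. For such a set \<open>A\<close> of densities put
  \<open>L n = \<integral>\<^sub>A (\<Prod>i\<le>n. q (X i) / p\<^sub>0 (X i)) d\<Pi>\<close>. The ratio \<open>L (n+1) / L n\<close> is the likelihood ratio at
  \<open>X (n+1)\<close> of a mixture of members of \<open>A\<close>, so that \<open>E \<surd>(L n) \<le> \<rho>\<^sup>n\<close>. This replaces tests and the minimax
  theorem, and bounds the numerator of the posterior by Markov's inequality. The denominator is at
  least \<open>exp (- 3 n \<epsilon>\<^sup>2) / 2\<close> with probability tending to \<open>1\<close>: Chebyshev's inequality bounds the
  log-likelihood ratio for each density in the Kullback--Leibler neighbourhood, and Fubini's theorem
  carries this over to most of the neighbourhood. Both signs of the moment difference and
  \<open>\<delta> = 5 \<surd>(K+1) \<epsilon>\<close> give the theorem.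
\<close>

section \<open>Hellinger affinity of two densities with separated moments\<close>

text \<open>Cauchy-Schwarz in AM-GM form. With \<open>u = sqrt f\<close> and
  \<open>v = sqrt g\<close>, \<open>h * (g - f)\<close> is \<open>h * (u + v)\<close> times
  \<open>v - u\<close>; the weight \<open>t\<close> splits this product into
  \<open>t / 2 * (v - u)\<^sup>2\<close> and \<open>h\<^sup>2 * (u + v)\<^sup>2 / (2 * t)\<close>,
  and \<open>(u + v)\<^sup>2 \<le> 2 * (f + g)\<close>. The terms are arranged so that none is
  subtracted, and the inequality can be integrated in \<open>ennreal\<close>.\<close>

lemma affinity_pointwise:
  fixes h f g t :: real
  assumes "0 \<le> h" "0 \<le> f" "0 \<le> g" "0 < t"
  shows "h * g + t * sqrt (f * g) \<le> h * f + t / 2 * (f + g) + h\<^sup>2 * (f + g) / t"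
proof -
  define u v where "u = sqrt f" and "v = sqrt g"
  have f: "f = u\<^sup>2" and g: "g = v\<^sup>2" and s: "sqrt (f * g) = u * v"
    and uv: "0 \<le> u" "0 \<le> v"
    using assms by (auto simp: u_def v_def real_sqrt_mult)
  \<comment> \<open>This sum of squares is \<open>2 * t\<close> times the difference of the two
    sides.\<close>
  have "0 \<le> (t * (u - v) + h * (u + v))\<^sup>2 + h\<^sup>2 * (u - v)\<^sup>2"
    by simp
  then have "2 * t * (h * v\<^sup>2 + t * (u * v)) \<le> 2 * t * (h * u\<^sup>2 + t / 2 * (u\<^sup>2 + v\<^sup>2)) + 2 * h\<^sup>2 * (u\<^sup>2 + v\<^sup>2)"
    by (simp add: power2_eq_square algebra_simps)
  also have "\<dots> = 2 * t * (h * u\<^sup>2 + t / 2 * (u\<^sup>2 + v\<^sup>2) + h\<^sup>2 * (u\<^sup>2 + v\<^sup>2) / t)"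
    using assms by (simp add: field_simps)
  finally show ?thesis
    unfolding s using assms by (simp only: f g) (simp add: mult_le_cancel_left)
qed

text \<open>Integrating \<open>affinity_pointwise\<close> gives
  \<open>\<delta> + t * a \<le> t + 2 * K / t\<close> for the affinity \<open>a\<close>, that is,
  \<open>a \<le> 1 - \<delta> / t + 2 * K / t\<^sup>2\<close>. At the best \<open>t\<close> the
  right side is \<open>1 - \<delta>\<^sup>2 / (8 * K)\<close>, which is at most the
  exponential.\<close>

lemma hellinger_affinity_le:
  fixes f g h :: "'a \<Rightarrow> real"
  assumes [measurable]: "f \<in> borel_measurable M" "g \<in> borel_measurable M" "h \<in> borel_measurable M"
    and nonneg: "\<And>x. 0 \<le> f x" "\<And>x. 0 \<le> g x" "\<And>x. 0 \<le> h x"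
    and f1: "(\<integral>\<^sup>+ x. ennreal (f x) \<partial>M) = 1" and g1: "(\<integral>\<^sup>+ x. ennreal (g x) \<partial>M) = 1"
    and f2: "(\<integral>\<^sup>+ x. ennreal ((h x)\<^sup>2 * f x) \<partial>M) \<le> ennreal K"
    and g2: "(\<integral>\<^sup>+ x. ennreal ((h x)\<^sup>2 * g x) \<partial>M) \<le> ennreal K"
    and "0 < K" "0 < \<delta>"
    and sep: "(\<integral>\<^sup>+ x. ennreal (h x * f x) \<partial>M) + ennreal \<delta> \<le> (\<integral>\<^sup>+ x. ennreal (h x * g x) \<partial>M)"
  shows "(\<integral>\<^sup>+ x. ennreal (sqrt (f x * g x)) \<partial>M) \<le> ennreal (exp (- \<delta>\<^sup>2 / (8 * K)))"
proof -
  \<comment> \<open>minimises \<open>2 * K / t\<^sup>2 - \<delta> / t\<close>\<close>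
  define t where "t = 4 * K / \<delta>"
  have t: "0 < t" using \<open>0 < K\<close> \<open>0 < \<delta>\<close> by (simp add: t_def)
  let ?a = "\<integral>\<^sup>+ x. ennreal (sqrt (f x * g x)) \<partial>M"
  let ?mf = "\<integral>\<^sup>+ x. ennreal (h x * f x) \<partial>M"
  let ?mg = "\<integral>\<^sup>+ x. ennreal (h x * g x) \<partial>M"
  let ?f2 = "\<integral>\<^sup>+ x. ennreal ((h x)\<^sup>2 * f x) \<partial>M"
  let ?g2 = "\<integral>\<^sup>+ x. ennreal ((h x)\<^sup>2 * g x) \<partial>M"
  \<comment> \<open>The first moment of \<open>f\<close> is finite because
    \<open>h \<le> 1 + h\<^sup>2\<close>; it can therefore be cancelled in the integrated
    inequality.\<close>
  have "?mf \<le> (\<integral>\<^sup>+ x. ennreal (f x) + ennreal ((h x)\<^sup>2 * f x) \<partial>M)"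
  proof (rule nn_integral_mono)
    fix x
    have "h x \<le> 1 + (h x)\<^sup>2"
      using sum_squares_ge_zero[of "h x - 1" "h x"] nonneg(3)[of x] by (simp add: power2_eq_square algebra_simps)
    then have "h x * f x \<le> (1 + (h x)\<^sup>2) * f x"
      by (rule mult_right_mono) (rule nonneg)
    then show "ennreal (h x * f x) \<le> ennreal (f x) + ennreal ((h x)\<^sup>2 * f x)"
      using nonneg by (simp flip: ennreal_plus add: algebra_simps ennreal_leI)
  qed
  also have "\<dots> \<le> 1 + ennreal K"
    using f1 f2 by (simp add: nn_integral_add)
  also have "\<dots> < \<infinity>" by simp
  finally have fin: "?mf < \<infinity>" .
  have "?mg + ennreal t * ?a = (\<integral>\<^sup>+ x. ennreal (h x * g x + t * sqrt (f x * g x)) \<partial>M)"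
    using nonneg t by (simp add: nn_integral_add nn_integral_cmult ennreal_mult)
  also have "\<dots> \<le> (\<integral>\<^sup>+ x. ennreal (h x * f x + (t / 2 * f x + t / 2 * g x) + (1 / t * ((h x)\<^sup>2 * f x) + 1 / t * ((h x)\<^sup>2 * g x))) \<partial>M)"
  proof (intro nn_integral_mono ennreal_leI)
    fix x
    show "h x * g x + t * sqrt (f x * g x) \<le> h x * f x + (t / 2 * f x + t / 2 * g x) + (1 / t * ((h x)\<^sup>2 * f x) + 1 / t * ((h x)\<^sup>2 * g x))"
      using affinity_pointwise[OF nonneg(3,1,2) t, of x x x] by (simp add: algebra_simps add_divide_distrib)
  qed
  also have "\<dots> = ?mf + (ennreal (t/2) * 1 + ennreal (t/2) * 1) + (ennreal (1/t) * ?f2 + ennreal (1/t) * ?g2)"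
    using nonneg t
    by (simp add: nn_integral_add nn_integral_cmult ennreal_mult f1 g1 del: divide_const_simps times_divide_eq_left)
  also have "\<dots> \<le> ?mf + (ennreal (t/2) * 1 + ennreal (t/2) * 1) + (ennreal (1/t) * ennreal K + ennreal (1/t) * ennreal K)"
    by (intro add_mono mult_left_mono f2 g2) auto
  also have "\<dots> = ?mf + ennreal (t + 2 * K / t)"
    using t \<open>0 < K\<close> by (simp flip: ennreal_plus ennreal_mult add: add_ac)
  finally have "?mg + ennreal t * ?a \<le> ?mf + ennreal (t + 2 * K / t)" .
  then have "?mf + (ennreal \<delta> + ennreal t * ?a) \<le> ?mf + ennreal (t + 2 * K / t)"
    using order_trans[OF add_right_mono[OF sep, of "ennreal t * ?a"]] by (simp only: add_ac)
  then have *: "ennreal \<delta> + ennreal t * ?a \<le> ennreal (t + 2 * K / t)"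
    using fin by (auto simp: ennreal_add_left_cancel_le)
  then have "ennreal t * ?a < \<infinity>"
    by (metis ennreal_less_top infinity_ennreal_def le_less_trans ennreal_add_eq_top top.not_eq_extremum)
  then have "?a < \<infinity>" using t by (auto simp: ennreal_mult_less_top)
  then obtain a where a: "?a = ennreal a" "0 \<le> a"
    by (cases ?a) auto
  have "\<delta> + t * a \<le> t + 2 * K / t"
    using * a t \<open>0 < \<delta>\<close> \<open>0 < K\<close> by (simp flip: ennreal_plus ennreal_mult)
  moreover have "2 * K / t = \<delta> / 2" and "(- (\<delta> / 2)) / t = - \<delta>\<^sup>2 / (8 * K)"
    using \<open>0 < K\<close> \<open>0 < \<delta>\<close> by (simp_all add: t_def power2_eq_square)
  ultimately have "(a - 1) * t \<le> - (\<delta> / 2)"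
    by (simp add: algebra_simps)
  then have "a - 1 \<le> - (\<delta> / 2) / t"
    using t by (simp only: pos_le_divide_eq)
  then have "a \<le> 1 + (- \<delta>\<^sup>2 / (8 * K))"
    using \<open>(- (\<delta> / 2)) / t = - \<delta>\<^sup>2 / (8 * K)\<close> by linarith
  also have "\<dots> \<le> exp (- \<delta>\<^sup>2 / (8 * K))"
    by (rule exp_ge_add_one_self)
  finally show ?thesis unfolding a by (simp add: ennreal_leI)
qed

section \<open>Second moments of sums of independent variables\<close>

text \<open>The cross terms vanish, since each new summand is centred and independent of the partial
  sum. Integrability is carried through the induction because the expectation of a product of
  independent variables factorises only for integrable factors.\<close>

lemma (in prob_space) sum_indep_second_moment:
  fixes Y :: "'i \<Rightarrow> 'a \<Rightarrow> real"
  assumes "finite I" and "indep_vars (\<lambda>_. borel) Y I"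
    and "\<And>i. i \<in> I \<Longrightarrow> integrable M (\<lambda>\<omega>. (Y i \<omega>)\<^sup>2)"
    and "\<And>i. i \<in> I \<Longrightarrow> expectation (Y i) = 0"
  shows "integrable M (\<lambda>\<omega>. (\<Sum>i\<in>I. Y i \<omega>)\<^sup>2) \<and>
    expectation (\<lambda>\<omega>. (\<Sum>i\<in>I. Y i \<omega>)\<^sup>2) = (\<Sum>i\<in>I. expectation (\<lambda>\<omega>. (Y i \<omega>)\<^sup>2))"
  using assms
proof (induction I rule: finite_induct)
  case (insert i I)
  let ?S = "\<lambda>\<omega>. \<Sum>j\<in>I. Y j \<omega>"
  have rv[measurable]: "\<And>j. j \<in> insert i I \<Longrightarrow> random_variable borel (Y j)"
    using insert.prems(1) by (auto simp: indep_vars_def)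
  have [measurable]: "random_variable borel (Y i)" "random_variable borel ?S"
    using rv by (auto intro!: borel_measurable_sum)
  have IH: "integrable M (\<lambda>\<omega>. (?S \<omega>)\<^sup>2)"
    "expectation (\<lambda>\<omega>. (?S \<omega>)\<^sup>2) = (\<Sum>i\<in>I. expectation (\<lambda>\<omega>. (Y i \<omega>)\<^sup>2))"
    using insert.IH[OF indep_vars_subset[OF insert.prems(1)]] insert.prems by auto
  have intS: "integrable M ?S" and intY: "integrable M (Y i)"
    using IH(1) insert.prems(2)[of i] by (auto intro: square_integrable_imp_integrable)
  have ind: "indep_var borel (Y i) borel ?S"
    by (rule indep_vars_sum) (use insert in auto)
  have intP: "integrable M (\<lambda>\<omega>. Y i \<omega> * ?S \<omega>)"
    and P0: "expectation (\<lambda>\<omega>. Y i \<omega> * ?S \<omega>) = 0"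
    using indep_var_integrable[OF ind intY intS] indep_var_lebesgue_integral[OF ind intY intS]
      insert.prems(3)[of i] by auto
  have eq: "(\<Sum>j\<in>insert i I. Y j \<omega>)\<^sup>2 = (Y i \<omega>)\<^sup>2 + 2 * (Y i \<omega> * ?S \<omega>) + (?S \<omega>)\<^sup>2" for \<omega>
    using insert.hyps by (simp add: power2_sum algebra_simps)
  show ?case
    unfolding eq using insert.prems(2)[of i] intP P0 IH insert.hyps by simp
qed simp

section \<open>Extended square root and laws given by a density\<close>

text \<open>\<open>esqrt \<infinity> = \<infinity>\<close> makes the bounds below hold without first excluding infinite likelihood integrals.\<close>

definition esqrt :: "ennreal \<Rightarrow> ennreal" where
  "esqrt x = (if x = \<infinity> then \<infinity> else ennreal (sqrt (enn2real x)))"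

lemma esqrt_ennreal [simp]: "0 \<le> x \<Longrightarrow> esqrt (ennreal x) = ennreal (sqrt x)"
  by (simp add: esqrt_def)

lemma esqrt_0 [simp]: "esqrt 0 = 0"
  by (simp add: esqrt_def)

lemma measurable_esqrt [measurable]: "esqrt \<in> borel_measurable borel"
  unfolding esqrt_def by measurable

lemma esqrt_top [simp]: "esqrt \<top> = \<top>"
  by (simp add: esqrt_def)

lemma esqrt_mono: "x \<le> y \<Longrightarrow> esqrt x \<le> esqrt y"
  by (cases x; cases y) (simp_all add: ennreal_leI top_unique)

lemma nn_integral_law_of:
  assumes [measurable]: "q \<in> borel_measurable borel" "f \<in> borel_measurable borel"
  shows "(\<integral>\<^sup>+ x. f x \<partial>law_of q) = (\<integral>\<^sup>+ x. ennreal (q x) * f x \<partial>lborel)"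
  unfolding law_of_def by (rule nn_integral_density) auto

lemma prob_space_law_of: "is_density q \<Longrightarrow> prob_space (law_of q)"
  unfolding is_density_def law_of_def
  by (intro prob_spaceI) (auto simp: emeasure_density)

lemma sets_law_of [simp, measurable_cong]: "sets (law_of q) = sets borel"
  by (simp add: law_of_def)

lemma space_law_of [simp]: "space (law_of q) = UNIV"
  by (simp add: law_of_def)

section \<open>Affinity of mixtures, for one and for \<open>n\<close> observations\<close>

text \<open>Composition rule for a curried kernel. Instantiated with a given \<open>k\<close>, it is
  declared as a measurability rule, so that likelihood products are handled automatically.\<close>

lemma measurable_kernel_comp:
  assumes "(\<lambda>(q, x). k q x) \<in> borel_measurable (N \<Otimes>\<^sub>M L)"
    and "g \<in> measurable R N" and "h \<in> measurable R L"
  shows "(\<lambda>w. k (g w) (h w)) \<in> borel_measurable R"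
  using measurable_compose[OF measurable_Pair[OF assms(2,3)] assms(1)] by simp

text \<open>The normalised mixture \<open>f\<close> of the densities \<open>k q\<close> is again a
  density. Averaging over \<open>N\<close> preserves the bound on the moment of
  \<open>h\<^sup>2\<close>, and it preserves the separation when all members are separated in the
  same direction; hence the disjunction stands outside the quantifier over \<open>q\<close>. Then
  \<open>hellinger_affinity_le\<close> applies to \<open>f\<close> and \<open>p0\<close>. The total
  mass of \<open>N\<close> is arbitrary because \<open>N\<close> will be a prior weighted by the
  likelihood of earlier observations.\<close>

lemma mixture_step:
  fixes N :: "'b measure" and k :: "'b \<Rightarrow> real \<Rightarrow> real" and h p0 :: "real \<Rightarrow> real"
  assumes k: "(\<lambda>(q, x). k q x) \<in> borel_measurable (N \<Otimes>\<^sub>M borel)"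
    and dens: "\<And>q. q \<in> space N \<Longrightarrow> is_density (k q)" and p0: "is_density p0"
    and h[measurable]: "h \<in> borel_measurable borel" and h0: "\<And>x. 0 \<le> h x"
    and k2: "AE q in N. (\<integral>\<^sup>+ x. ennreal ((h x)\<^sup>2 * k q x) \<partial>lborel) \<le> ennreal K"
    and p2: "(\<integral>\<^sup>+ x. ennreal ((h x)\<^sup>2 * p0 x) \<partial>lborel) \<le> ennreal K"
    and "0 < K" "0 < \<delta>"
    and sep: "(AE q in N. (\<integral>\<^sup>+ x. ennreal (h x * k q x) \<partial>lborel) + ennreal \<delta>
                 \<le> (\<integral>\<^sup>+ x. ennreal (h x * p0 x) \<partial>lborel)) \<or>
              (AE q in N. (\<integral>\<^sup>+ x. ennreal (h x * p0 x) \<partial>lborel) + ennreal \<delta>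
                 \<le> (\<integral>\<^sup>+ x. ennreal (h x * k q x) \<partial>lborel))"
  shows "(\<integral>\<^sup>+ y. esqrt (\<integral>\<^sup>+ q. ennreal (k q y / p0 y) \<partial>N) \<partial>law_of p0)
           \<le> ennreal (exp (- \<delta>\<^sup>2 / (8 * K))) * esqrt (emeasure N (space N))"
proof -
  \<comment> \<open>With infinite mass the right side is infinite, with zero mass the left side is
    0; only the remaining case can be normalised.\<close>
  consider "emeasure N (space N) = \<infinity>" | "emeasure N (space N) = 0"
    | "emeasure N (space N) \<noteq> 0" "emeasure N (space N) \<noteq> \<infinity>" by auto
  then show ?thesis
  proof cases
    case 1
    then show ?thesis by (simp add: esqrt_def ennreal_mult_top)
  next
    case 2
    then have "N = null_measure N"
      by (intro measure_eqI) (auto intro: emeasure_eq_0[OF sets.top] dest: sets.sets_into_space)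
    then have "(\<integral>\<^sup>+ q. ennreal (k q y / p0 y) \<partial>N) = 0" for y
      by (metis nn_integral_null_measure)
    then show ?thesis by simp
  next
    case 3
    interpret N: finite_measure N
      by (rule finite_measureI) (use 3 in auto)
    interpret pair_sigma_finite N "lborel :: real measure" ..
    have [measurable]: "p0 \<in> borel_measurable borel" and p0': "\<And>x. 0 \<le> p0 x"
      and p1: "(\<integral>\<^sup>+ x. ennreal (p0 x) \<partial>lborel) = 1"
      using p0 by (auto simp: is_density_def)
    have kpos: "q \<in> space N \<Longrightarrow> 0 \<le> k q x" for q x
      using dens by (auto simp: is_density_def)
    note measurable_kernel_comp[OF k, measurable (raw)]
    define c where "c = measure N (space N)"
    have c: "emeasure N (space N) = ennreal c" and cpos: "0 < c"
      using 3 by (auto simp: c_def N.emeasure_eq_measure zero_less_measure_iff)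
    define m where "m y = (\<integral>\<^sup>+ q. ennreal (k q y) \<partial>N)" for y
    \<comment> \<open>\<open>m\<close> is infinite at most on a null set, where
      \<open>enn2real\<close> makes \<open>f\<close> equal to 0.\<close>
    define f where "f y = enn2real (m y) / c" for y
    have m_meas[measurable]: "m \<in> borel_measurable borel"
      unfolding m_def by measurable
    have f_meas[measurable]: "f \<in> borel_measurable borel"
      unfolding f_def by measurable
    have f0: "0 \<le> f y" for y
      using cpos by (simp add: f_def)
    have swap: "(\<integral>\<^sup>+ y. ennreal (\<phi> y) * m y \<partial>lborel) = (\<integral>\<^sup>+ q. (\<integral>\<^sup>+ y. ennreal (\<phi> y * k q y) \<partial>lborel) \<partial>N)"
      if [measurable]: "\<phi> \<in> borel_measurable borel" and "\<And>y. 0 \<le> \<phi> y" for \<phi>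
    proof -
      have "(\<integral>\<^sup>+ y. ennreal (\<phi> y) * m y \<partial>lborel) = (\<integral>\<^sup>+ y. (\<integral>\<^sup>+ q. ennreal (\<phi> y) * ennreal (k q y) \<partial>N) \<partial>lborel)"
        unfolding m_def by (intro nn_integral_cong nn_integral_cmult[symmetric]) measurable
      also have "\<dots> = (\<integral>\<^sup>+ q. (\<integral>\<^sup>+ y. ennreal (\<phi> y) * ennreal (k q y) \<partial>lborel) \<partial>N)"
        by (rule Fubini') measurable
      also have "\<dots> = (\<integral>\<^sup>+ q. (\<integral>\<^sup>+ y. ennreal (\<phi> y * k q y) \<partial>lborel) \<partial>N)"
        using that by (intro nn_integral_cong ennreal_mult[symmetric] kpos) auto
      finally show ?thesis .
    qed
    have "(\<integral>\<^sup>+ y. m y \<partial>lborel) = (\<integral>\<^sup>+ q. (\<integral>\<^sup>+ y. ennreal (k q y) \<partial>lborel) \<partial>N)"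
      using swap[of "\<lambda>_. 1"] by simp
    also have "\<dots> = (\<integral>\<^sup>+ q. 1 \<partial>N)"
      using dens by (intro nn_integral_cong) (auto simp: is_density_def)
    also have "\<dots> = ennreal c" by (simp add: c)
    finally have m_int: "(\<integral>\<^sup>+ y. m y \<partial>lborel) = ennreal c" .
    have "AE y in lborel. m y \<noteq> \<infinity>"
      by (rule nn_integral_noteq_infinite) (auto simp: m_int)
    then have m_eq: "AE y in lborel. m y = ennreal (c * f y)"
      using cpos by (auto simp: f_def less_top)
    have mix: "(\<integral>\<^sup>+ y. ennreal (\<phi> y * f y) \<partial>lborel)
        = ennreal (1 / c) * (\<integral>\<^sup>+ q. (\<integral>\<^sup>+ y. ennreal (\<phi> y * k q y) \<partial>lborel) \<partial>N)"
      if [measurable]: "\<phi> \<in> borel_measurable borel" and \<phi>: "\<And>y. 0 \<le> \<phi> y" for \<phi>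
    proof -
      have "(\<integral>\<^sup>+ y. ennreal (\<phi> y * f y) \<partial>lborel) = (\<integral>\<^sup>+ y. ennreal (1 / c) * (ennreal (\<phi> y) * m y) \<partial>lborel)"
        using m_eq cpos \<phi> f0
        by (intro nn_integral_cong_AE) (auto simp: ennreal_mult'[symmetric] ennreal_mult[symmetric] simp del: divide_const_simps)
      then show ?thesis
        using swap[OF that] by (simp add: nn_integral_cmult)
    qed
    have cc: "ennreal (1 / c) * (x * ennreal c) = x" for x
    proof -
      have "ennreal (1 / c) * ennreal c = 1"
        using cpos by (simp flip: ennreal_mult)
      then show ?thesis by (metis mult.assoc mult.commute mult_1)
    qed
    have f1: "(\<integral>\<^sup>+ y. ennreal (f y) \<partial>lborel) = 1"
      using mix[of "\<lambda>_. 1"] swap[of "\<lambda>_. 1"] m_int cc[of 1] by simp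
    have f2: "(\<integral>\<^sup>+ y. ennreal ((h y)\<^sup>2 * f y) \<partial>lborel) \<le> ennreal K"
    proof -
      have "(\<integral>\<^sup>+ y. ennreal ((h y)\<^sup>2 * f y) \<partial>lborel) \<le> ennreal (1 / c) * (\<integral>\<^sup>+ q. ennreal K \<partial>N)"
        by (subst mix) (auto simp del: nn_integral_const intro!: mult_left_mono nn_integral_mono_AE k2)
      then show ?thesis by (simp add: c cc)
    qed
    have aff: "(\<integral>\<^sup>+ y. ennreal (sqrt (f y * p0 y)) \<partial>lborel) \<le> ennreal (exp (- \<delta>\<^sup>2 / (8 * K)))"
      using sep
    proof
      assume *: "AE q in N. (\<integral>\<^sup>+ x. ennreal (h x * k q x) \<partial>lborel) + ennreal \<delta>
                 \<le> (\<integral>\<^sup>+ x. ennreal (h x * p0 x) \<partial>lborel)"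
      have "(\<integral>\<^sup>+ y. ennreal (h y * f y) \<partial>lborel) + ennreal \<delta> =
          ennreal (1 / c) * (\<integral>\<^sup>+ q. (\<integral>\<^sup>+ x. ennreal (h x * k q x) \<partial>lborel) + ennreal \<delta> \<partial>N)"
        by (subst mix) (auto simp: h0 nn_integral_add c distrib_left cc)
      also have "\<dots> \<le> ennreal (1 / c) * (\<integral>\<^sup>+ q. (\<integral>\<^sup>+ x. ennreal (h x * p0 x) \<partial>lborel) \<partial>N)"
        by (intro mult_left_mono nn_integral_mono_AE *) auto
      also have "\<dots> = (\<integral>\<^sup>+ x. ennreal (h x * p0 x) \<partial>lborel)"
        by (simp add: c cc)
      finally show ?thesis
        by (intro hellinger_affinity_le[where h=h]) (use f0 p0' h0 f1 p1 f2 p2 \<open>0 < K\<close> \<open>0 < \<delta>\<close> in auto)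
    next
      assume *: "AE q in N. (\<integral>\<^sup>+ x. ennreal (h x * p0 x) \<partial>lborel) + ennreal \<delta>
                 \<le> (\<integral>\<^sup>+ x. ennreal (h x * k q x) \<partial>lborel)"
      have "(\<integral>\<^sup>+ x. ennreal (h x * p0 x) \<partial>lborel) + ennreal \<delta> =
          ennreal (1 / c) * (\<integral>\<^sup>+ q. (\<integral>\<^sup>+ x. ennreal (h x * p0 x) \<partial>lborel) + ennreal \<delta> \<partial>N)"
        by (simp add: c cc)
      also have "\<dots> \<le> ennreal (1 / c) * (\<integral>\<^sup>+ q. (\<integral>\<^sup>+ x. ennreal (h x * k q x) \<partial>lborel) \<partial>N)"
        by (intro mult_left_mono nn_integral_mono_AE *) auto
      also have "\<dots> = (\<integral>\<^sup>+ y. ennreal (h y * f y) \<partial>lborel)"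
        by (subst mix) (auto simp: h0)
      \<comment> \<open>Here \<open>p0\<close> has the smaller moment and takes the first place; the
        affinity is symmetric.\<close>
      finally have "(\<integral>\<^sup>+ y. ennreal (sqrt (p0 y * f y)) \<partial>lborel) \<le> ennreal (exp (- \<delta>\<^sup>2 / (8 * K)))"
        by (intro hellinger_affinity_le[where h=h]) (use f0 p0' h0 f1 p1 f2 p2 \<open>0 < K\<close> \<open>0 < \<delta>\<close> in auto)
      then show ?thesis by (simp add: mult.commute)
    qed
    have "(\<integral>\<^sup>+ y. esqrt (\<integral>\<^sup>+ q. ennreal (k q y / p0 y) \<partial>N) \<partial>law_of p0)
        = (\<integral>\<^sup>+ y. ennreal (p0 y) * esqrt (\<integral>\<^sup>+ q. ennreal (k q y / p0 y) \<partial>N) \<partial>lborel)"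
      by (rule nn_integral_law_of) measurable
    \<comment> \<open>Where \<open>p0 y > 0\<close> this is
      \<open>p0 * sqrt (c * f / p0) = sqrt c * sqrt (f * p0)\<close>. Where \<open>p0 y = 0\<close>
      both sides are 0, whatever value the division by zero has.\<close>
    also have "\<dots> = (\<integral>\<^sup>+ y. ennreal (sqrt c) * ennreal (sqrt (f y * p0 y)) \<partial>lborel)"
    proof (rule nn_integral_cong_AE, use m_eq in eventually_elim)
      case (elim y)
      show ?case
      proof (cases "p0 y = 0")
        case False
        then have py: "0 < p0 y" using p0'[of y] by simp
        have "(\<integral>\<^sup>+ q. ennreal (k q y / p0 y) \<partial>N) = (\<integral>\<^sup>+ q. ennreal (1 / p0 y) * ennreal (k q y) \<partial>N)"
          using py kpos by (intro nn_integral_cong) (simp flip: ennreal_mult)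
        also have "\<dots> = ennreal (1 / p0 y) * m y"
          unfolding m_def by (rule nn_integral_cmult) measurable
        also have "\<dots> = ennreal (c * f y / p0 y)"
          using elim py cpos f0[of y] by (simp flip: ennreal_mult)
        finally have "esqrt (\<integral>\<^sup>+ q. ennreal (k q y / p0 y) \<partial>N) = ennreal (sqrt (c * f y / p0 y))"
          using cpos py f0[of y] by simp
        moreover have "p0 y * sqrt (c * f y / p0 y) = sqrt c * sqrt (f y * p0 y)"
        proof -
          have "p0 y = sqrt (p0 y) * sqrt (p0 y)" using py by simp
          then show ?thesis using py
            by (simp add: real_sqrt_mult real_sqrt_divide field_simps)
        qed
        ultimately show ?thesis
          using py cpos f0[of y] by (simp flip: ennreal_mult)
      qed simp
    qed
    also have "\<dots> = ennreal (sqrt c) * (\<integral>\<^sup>+ y. ennreal (sqrt (f y * p0 y)) \<partial>lborel)"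
      by (rule nn_integral_cmult) measurable
    also have "\<dots> \<le> ennreal (sqrt c) * ennreal (exp (- \<delta>\<^sup>2 / (8 * K)))"
      by (intro mult_left_mono aff) auto
    also have "\<dots> = ennreal (exp (- \<delta>\<^sup>2 / (8 * K))) * esqrt (emeasure N (space N))"
      using cpos by (simp add: c mult.commute)
    finally show ?thesis .
  qed
qed

text \<open>
  The likelihood of the first \<open>n\<close> observations is absorbed into the mixing measure, to which
  \<open>mixture_step\<close> is applied for observation \<open>n + 1\<close>.
\<close>

lemma product_affinity:
  fixes N :: "'b measure" and k :: "'b \<Rightarrow> real \<Rightarrow> real" and h p0 :: "real \<Rightarrow> real"
  assumes k: "(\<lambda>(q, x). k q x) \<in> borel_measurable (N \<Otimes>\<^sub>M borel)" and "finite_measure N"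
    and dens: "\<And>q. q \<in> space N \<Longrightarrow> is_density (k q)" and p0: "is_density p0"
    and h[measurable]: "h \<in> borel_measurable borel" and h0: "\<And>x. 0 \<le> h x"
    and k2: "AE q in N. (\<integral>\<^sup>+ x. ennreal ((h x)\<^sup>2 * k q x) \<partial>lborel) \<le> ennreal K"
    and p2: "(\<integral>\<^sup>+ x. ennreal ((h x)\<^sup>2 * p0 x) \<partial>lborel) \<le> ennreal K"
    and "0 < K" "0 < \<delta>"
    and sep: "(AE q in N. (\<integral>\<^sup>+ x. ennreal (h x * k q x) \<partial>lborel) + ennreal \<delta>
                 \<le> (\<integral>\<^sup>+ x. ennreal (h x * p0 x) \<partial>lborel)) \<or>
              (AE q in N. (\<integral>\<^sup>+ x. ennreal (h x * p0 x) \<partial>lborel) + ennreal \<delta>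
                 \<le> (\<integral>\<^sup>+ x. ennreal (h x * k q x) \<partial>lborel))"
  shows "(\<integral>\<^sup>+ x. esqrt (\<integral>\<^sup>+ q. ennreal (\<Prod>i=1..n. k q (x i) / p0 (x i)) \<partial>N) \<partial>PiM {1..n} (\<lambda>_. law_of p0))
           \<le> ennreal (exp (- \<delta>\<^sup>2 / (8 * K)) ^ n) * esqrt (emeasure N (space N))"
proof (induction n)
  case 0
  interpret finite_measure N by fact
  interpret product_sigma_finite "\<lambda>_::nat. law_of p0"
    by (simp add: product_sigma_finite_def prob_space_law_of[OF p0] prob_space_imp_sigma_finite)
  show ?case by (simp add: PiM_empty nn_integral_count_space_finite)
next
  case (Suc n)
  interpret finite_measure N by fact
  interpret P: prob_space "law_of p0" by (rule prob_space_law_of[OF p0])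
  interpret product_sigma_finite "\<lambda>_::nat. law_of p0"
    by (simp add: product_sigma_finite_def P.sigma_finite_measure)
  have [measurable]: "p0 \<in> borel_measurable borel" and p0': "\<And>x. 0 \<le> p0 x"
    using p0 by (auto simp: is_density_def)
  have kpos: "q \<in> space N \<Longrightarrow> 0 \<le> k q x" for q x
    using dens by (auto simp: is_density_def)
  note measurable_kernel_comp[OF k, measurable (raw)]
  let ?P = "\<lambda>n. PiM {1..n::nat} (\<lambda>_. law_of p0)"
  let ?W = "\<lambda>n q x. \<Prod>i=1..n. k q (x i) / p0 (x i)"
  let ?\<rho> = "exp (- \<delta>\<^sup>2 / (8 * K))"
  have Wm[measurable]: "(\<lambda>(x, q). ?W n q x) \<in> borel_measurable (?P n \<Otimes>\<^sub>M N)" for n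
    by measurable
  have fm: "(\<lambda>x. esqrt (\<integral>\<^sup>+ q. ennreal (?W n q x) \<partial>N)) \<in> borel_measurable (?P n)" for n
    by measurable
  have ins: "{1..Suc n} = insert (Suc n) {1..n}" by auto
  have step: "(\<integral>\<^sup>+ y. esqrt (\<integral>\<^sup>+ q. ennreal (?W (Suc n) q (x(Suc n := y))) \<partial>N) \<partial>law_of p0)
      \<le> ennreal ?\<rho> * esqrt (\<integral>\<^sup>+ q. ennreal (?W n q x) \<partial>N)" if x: "x \<in> space (?P n)" for x
  proof -
    have Wx[measurable]: "(\<lambda>q. ennreal (?W n q x)) \<in> borel_measurable N"
      by measurable
    let ?D = "density N (\<lambda>q. ennreal (?W n q x))"
    have Wpos: "0 \<le> ?W n q x" if "q \<in> space N" for q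
      using kpos[OF that] p0' by (intro prod_nonneg) auto
    have "(\<integral>\<^sup>+ q. ennreal (?W (Suc n) q (x(Suc n := y))) \<partial>N) = (\<integral>\<^sup>+ q. ennreal (k q y / p0 y) \<partial>?D)" for y
    proof -
      have "(\<integral>\<^sup>+ q. ennreal (k q y / p0 y) \<partial>?D) = (\<integral>\<^sup>+ q. ennreal (?W n q x) * ennreal (k q y / p0 y) \<partial>N)"
        by (rule nn_integral_density) measurable
      also have "\<dots> = (\<integral>\<^sup>+ q. ennreal (?W (Suc n) q (x(Suc n := y))) \<partial>N)"
      proof (rule nn_integral_cong)
        fix q assume q: "q \<in> space N"
        have "?W (Suc n) q (x(Suc n := y)) = ?W n q x * (k q y / p0 y)"
          by simp
        then show "ennreal (?W n q x) * ennreal (k q y / p0 y) = ennreal (?W (Suc n) q (x(Suc n := y)))"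
          using Wpos[OF q] kpos[OF q] p0' by (simp only: ennreal_mult divide_nonneg_nonneg)
      qed
      finally show ?thesis by simp
    qed
    \<comment> \<open>Null sets of \<open>N\<close> remain null for \<open>?D\<close>, so that
      constraints holding almost everywhere survive the weighting by the likelihood.\<close>
    moreover have sub: "AE q in ?D. P q" if "AE q in N. P q" for P
      using that by (subst AE_density) auto
    ultimately have "(\<integral>\<^sup>+ y. esqrt (\<integral>\<^sup>+ q. ennreal (?W (Suc n) q (x(Suc n := y))) \<partial>N) \<partial>law_of p0)
        = (\<integral>\<^sup>+ y. esqrt (\<integral>\<^sup>+ q. ennreal (k q y / p0 y) \<partial>?D) \<partial>law_of p0)"
      by simp
    also have "\<dots> \<le> ennreal ?\<rho> * esqrt (emeasure ?D (space ?D))"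
    proof (rule mixture_step[where h = h])
      show "(\<lambda>(q, x). k q x) \<in> borel_measurable (?D \<Otimes>\<^sub>M borel)"
        using k by (simp cong: measurable_cong_sets sets_pair_measure_cong)
      show "AE q in ?D. (\<integral>\<^sup>+ x. ennreal ((h x)\<^sup>2 * k q x) \<partial>lborel) \<le> ennreal K"
        by (rule sub) (rule k2)
      show "(AE q in ?D. (\<integral>\<^sup>+ x. ennreal (h x * k q x) \<partial>lborel) + ennreal \<delta>
                 \<le> (\<integral>\<^sup>+ x. ennreal (h x * p0 x) \<partial>lborel)) \<or>
              (AE q in ?D. (\<integral>\<^sup>+ x. ennreal (h x * p0 x) \<partial>lborel) + ennreal \<delta>
                 \<le> (\<integral>\<^sup>+ x. ennreal (h x * k q x) \<partial>lborel))"
        using sep by (rule disj_forward) (erule sub)+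
    qed (use assms in auto)
    also have "emeasure ?D (space ?D) = (\<integral>\<^sup>+ q. ennreal (?W n q x) \<partial>N)"
      by (subst emeasure_density) (auto intro!: nn_integral_cong simp: indicator_def)
    finally show ?thesis .
  qed
  \<comment> \<open>Observation \<open>Suc n\<close> is integrated first, with the first
    \<open>n\<close> held fixed; this yields one more factor \<open>?\<rho>\<close>.\<close>
  have "(\<integral>\<^sup>+ x. esqrt (\<integral>\<^sup>+ q. ennreal (?W (Suc n) q x) \<partial>N) \<partial>?P (Suc n))
    = (\<integral>\<^sup>+ x. (\<integral>\<^sup>+ y. esqrt (\<integral>\<^sup>+ q. ennreal (?W (Suc n) q (x(Suc n := y))) \<partial>N) \<partial>law_of p0) \<partial>?P n)"
    unfolding ins by (rule product_nn_integral_insert) (use fm[of "Suc n"] in \<open>auto simp: ins\<close>)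
  also have "\<dots> \<le> (\<integral>\<^sup>+ x. ennreal ?\<rho> * esqrt (\<integral>\<^sup>+ q. ennreal (?W n q x) \<partial>N) \<partial>?P n)"
    by (intro nn_integral_mono step)
  also have "\<dots> = ennreal ?\<rho> * (\<integral>\<^sup>+ x. esqrt (\<integral>\<^sup>+ q. ennreal (?W n q x) \<partial>N) \<partial>?P n)"
    by (rule nn_integral_cmult) (rule fm)
  also have "\<dots> \<le> ennreal ?\<rho> * (ennreal (?\<rho> ^ n) * esqrt (emeasure N (space N)))"
    by (intro mult_left_mono Suc.IH) auto
  also have "\<dots> = ennreal (?\<rho> ^ Suc n) * esqrt (emeasure N (space N))"
    by (simp add: mult.assoc[symmetric] flip: ennreal_mult)
  finally show ?case .
qed

section \<open>Joint law of the sample and upper tail of the likelihood integral\<close>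

lemma (in prob_space) distr_eq_law_of:
  assumes "distributed M lborel Y (\<lambda>x. ennreal (p0 x))"
  shows "distr M borel Y = law_of p0"
proof -
  have "distr M borel Y = distr M lborel Y"
    by (rule distr_cong) auto
  then show ?thesis
    using distributed_distr_eq_density[OF assms] by (simp add: law_of_def)
qed

lemma (in prob_space) distr_iid:
  fixes X :: "nat \<Rightarrow> 'a \<Rightarrow> real"
  assumes "indep_vars (\<lambda>_. borel) X I" and "I \<noteq> {}"
    and dist: "\<And>i. i \<in> I \<Longrightarrow> distributed M lborel (X i) (\<lambda>x. ennreal (p0 x))"
  shows "distr M (\<Pi>\<^sub>M i\<in>I. borel) (\<lambda>\<omega>. \<lambda>i\<in>I. X i \<omega>) = PiM I (\<lambda>_. law_of p0)"
proof -
  have rv: "random_variable borel (X i)" if "i \<in> I" for i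
    using distributed_measurable[OF dist[OF that]] by simp
  have "distr M (\<Pi>\<^sub>M i\<in>I. borel) (\<lambda>\<omega>. \<lambda>i\<in>I. X i \<omega>) = (\<Pi>\<^sub>M i\<in>I. distr M borel (X i))"
    using indep_vars_iff_distr_eq_PiM'[where X = X and M' = "\<lambda>_. borel", OF \<open>I \<noteq> {}\<close>] rv assms(1)
    by blast
  also have "\<dots> = PiM I (\<lambda>_. law_of p0)"
  proof (rule PiM_cong)
    fix i assume "i \<in> I"
    then show "distr M borel (X i) = law_of p0"
      by (intro distr_eq_law_of dist)
  qed simp
  finally show ?thesis .
qed

text \<open>Markov's inequality for the square root of the likelihood integral, whose expectation
  \<open>product_affinity\<close> bounds once the sample is replaced by its joint law. The square
  root accounts for \<open>sqrt s\<close>. The condition \<open>1 \<le> n\<close> provides the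
  nonempty index set that \<open>distr_iid\<close> asks for.\<close>

lemma (in prob_space) likelihood_integral_tail:
  fixes X :: "nat \<Rightarrow> 'a \<Rightarrow> real" and N :: "'b measure" and k :: "'b \<Rightarrow> real \<Rightarrow> real" and h p0 :: "real \<Rightarrow> real"
  assumes indep: "indep_vars (\<lambda>_. borel) X {1..n}" and "1 \<le> n"
    and dist: "\<And>i. i \<in> {1..n} \<Longrightarrow> distributed M lborel (X i) (\<lambda>x. ennreal (p0 x))"
    and k: "(\<lambda>(q, x). k q x) \<in> borel_measurable (N \<Otimes>\<^sub>M borel)" and N: "finite_measure N"
    and dens: "\<And>q. q \<in> space N \<Longrightarrow> is_density (k q)" and p0: "is_density p0"
    and h[measurable]: "h \<in> borel_measurable borel" and h0: "\<And>x. 0 \<le> h x"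
    and k2: "AE q in N. (\<integral>\<^sup>+ x. ennreal ((h x)\<^sup>2 * k q x) \<partial>lborel) \<le> ennreal K"
    and p2: "(\<integral>\<^sup>+ x. ennreal ((h x)\<^sup>2 * p0 x) \<partial>lborel) \<le> ennreal K"
    and "0 < K" "0 < \<delta>"
    and sep: "(AE q in N. (\<integral>\<^sup>+ x. ennreal (h x * k q x) \<partial>lborel) + ennreal \<delta>
                 \<le> (\<integral>\<^sup>+ x. ennreal (h x * p0 x) \<partial>lborel)) \<or>
              (AE q in N. (\<integral>\<^sup>+ x. ennreal (h x * p0 x) \<partial>lborel) + ennreal \<delta>
                 \<le> (\<integral>\<^sup>+ x. ennreal (h x * k q x) \<partial>lborel))"
    and "0 < s"
  shows "emeasure M {\<omega> \<in> space M. ennreal s \<le> (\<integral>\<^sup>+ q. ennreal (\<Prod>i=1..n. k q (X i \<omega>) / p0 (X i \<omega>)) \<partial>N)}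
           \<le> ennreal (exp (- \<delta>\<^sup>2 / (8 * K)) ^ n / sqrt s) * esqrt (emeasure N (space N))"
proof -
  interpret N: finite_measure N by fact
  have [measurable]: "p0 \<in> borel_measurable borel"
    using p0 by (auto simp: is_density_def)
  have rv[measurable]: "random_variable borel (X i)" if "i \<in> {1..n}" for i
    using distributed_measurable[OF dist[OF that]] by simp
  note measurable_kernel_comp[OF k, measurable (raw)]
  let ?W = "\<lambda>q x. \<Prod>i=1..n. k q (x i) / p0 (x i)"
  let ?L = "\<lambda>x. \<integral>\<^sup>+ q. ennreal (?W q x) \<partial>N"
  let ?X = "\<lambda>\<omega>. \<lambda>i\<in>{1..n}. X i \<omega>"
  let ?\<rho> = "exp (- \<delta>\<^sup>2 / (8 * K))"
  \<comment> \<open>The joint law lives on functions restricted to \<open>{1..n}\<close>; the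
    likelihood reads only these coordinates.\<close>
  have W_eq: "?W q (\<lambda>i. X i \<omega>) = ?W q (?X \<omega>)" for q \<omega>
    by (intro prod.cong) auto
  have Lm[measurable]: "?L \<in> borel_measurable (\<Pi>\<^sub>M i\<in>{1..n}. borel)"
    by measurable
  have Xm[measurable]: "?X \<in> measurable M (\<Pi>\<^sub>M i\<in>{1..n}. borel)"
    by (rule measurable_restrict) (rule rv)
  have "emeasure M {\<omega> \<in> space M. ennreal s \<le> ?L (\<lambda>i. X i \<omega>)}
      \<le> emeasure M {\<omega> \<in> space M. 1 \<le> ennreal (1 / sqrt s) * esqrt (?L (?X \<omega>))}"
  proof (rule emeasure_mono)
    show "{\<omega> \<in> space M. 1 \<le> ennreal (1 / sqrt s) * esqrt (?L (?X \<omega>))} \<in> events"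
      by measurable
    show "{\<omega> \<in> space M. ennreal s \<le> ?L (\<lambda>i. X i \<omega>)} \<subseteq> {\<omega> \<in> space M. 1 \<le> ennreal (1 / sqrt s) * esqrt (?L (?X \<omega>))}"
    proof safe
      fix \<omega> assume "ennreal s \<le> ?L (\<lambda>i. X i \<omega>)"
      then have "esqrt (ennreal s) \<le> esqrt (?L (?X \<omega>))"
        unfolding W_eq by (rule esqrt_mono)
      then have "ennreal (1 / sqrt s) * ennreal (sqrt s) \<le> ennreal (1 / sqrt s) * esqrt (?L (?X \<omega>))"
        using \<open>0 < s\<close> by (intro mult_left_mono) auto
      then show "1 \<le> ennreal (1 / sqrt s) * esqrt (?L (?X \<omega>))"
        using \<open>0 < s\<close> by (simp flip: ennreal_mult)
    qed
  qed
  also have "\<dots> \<le> ennreal (1 / sqrt s) * (\<integral>\<^sup>+ \<omega>. esqrt (?L (?X \<omega>)) * indicator (space M) \<omega> \<partial>M)"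
    by (rule nn_integral_Markov_inequality) measurable
  also have "(\<integral>\<^sup>+ \<omega>. esqrt (?L (?X \<omega>)) * indicator (space M) \<omega> \<partial>M) = (\<integral>\<^sup>+ \<omega>. esqrt (?L (?X \<omega>)) \<partial>M)"
    by (intro nn_integral_cong) (simp add: indicator_def)
  also have "\<dots> = (\<integral>\<^sup>+ x. esqrt (?L x) \<partial>distr M (\<Pi>\<^sub>M i\<in>{1..n}. borel) ?X)"
    by (rule nn_integral_distr[symmetric]) measurable
  also have "distr M (\<Pi>\<^sub>M i\<in>{1..n}. borel) ?X = PiM {1..n} (\<lambda>_. law_of p0)"
    by (rule distr_iid) (use indep dist \<open>1 \<le> n\<close> in auto)
  also have "(\<integral>\<^sup>+ x. esqrt (?L x) \<partial>PiM {1..n} (\<lambda>_. law_of p0)) \<le> ennreal (?\<rho> ^ n) * esqrt (emeasure N (space N))"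
    by (rule product_affinity[OF k N dens p0 h h0 k2 p2 \<open>0 < K\<close> \<open>0 < \<delta>\<close> sep])
  also have "ennreal (1 / sqrt s) * (ennreal (?\<rho> ^ n) * esqrt (emeasure N (space N)))
      = ennreal (?\<rho> ^ n / sqrt s) * esqrt (emeasure N (space N))"
    using \<open>0 < s\<close> by (simp add: mult.assoc[symmetric] flip: ennreal_mult)
  finally show ?thesis by (simp add: mult_left_mono)
qed

section \<open>Lower bound for the likelihood integral from the Kullback-Leibler
  neighbourhood\<close>

lemma enn2ereal_le_ereal_iff: "0 \<le> b \<Longrightarrow> enn2ereal a \<le> ereal b \<longleftrightarrow> a \<le> ennreal b"
  by (cases a) (auto simp: top_ereal_def enn2ereal_ennreal top_unique)

text \<open>Passage from extended integrals to Bochner integrals. \<open>log_ratio\<close> is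
  infinite where \<open>q\<close> vanishes, so a finite integral of its square forces
  \<open>q > 0\<close> almost everywhere under \<open>law_of p0\<close>, and there it is the real
  logarithm. On a probability space square integrability gives integrability, so that the extended
  first moment is a difference of two finite numbers.\<close>

lemma log_ratio_moments:
  assumes p0: "is_density p0" and q: "is_density q"
    and kl1: "ext_integral (law_of p0) (\<lambda>x. log_ratio (p0 x) (q x)) \<le> ereal b"
    and kl2: "ext_integral (law_of p0) (\<lambda>x. (log_ratio (p0 x) (q x))\<^sup>2) \<le> ereal b" and "0 \<le> b"
  shows "AE x in law_of p0. 0 < p0 x \<and> 0 < q x"
    and "integrable (law_of p0) (\<lambda>x. (ln (p0 x / q x))\<^sup>2)"
    and "(\<integral>x. (ln (p0 x / q x))\<^sup>2 \<partial>law_of p0) \<le> b"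
    and "(\<integral>x. ln (p0 x / q x) \<partial>law_of p0) \<le> b"
proof -
  have [measurable]: "p0 \<in> borel_measurable borel" "q \<in> borel_measurable borel"
    and p0': "\<And>x. 0 \<le> p0 x" and q': "\<And>x. 0 \<le> q x"
    using p0 q by (auto simp: is_density_def)
  interpret P: prob_space "law_of p0" by (rule prob_space_law_of[OF p0])
  let ?g = "\<lambda>x. ln (p0 x / q x)"
  let ?l = "\<lambda>x. log_ratio (p0 x) (q x)"
  have [measurable]: "?l \<in> borel_measurable borel"
    unfolding log_ratio_def by measurable
  have [measurable]: "(\<lambda>x. (?l x)\<^sup>2) \<in> borel_measurable borel"
    unfolding power2_eq_square by measurable
  have nonneg: "0 \<le> (?l x)\<^sup>2" for x
    by (simp add: log_ratio_def)
  \<comment> \<open>A square has no negative part, so its \<open>ext_integral\<close> is a single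
    integral.\<close>
  have "(\<integral>\<^sup>+ x. e2ennreal (- (?l x)\<^sup>2) \<partial>law_of p0) = 0"
    using nonneg by (simp add: e2ennreal_neg)
  then have l2: "(\<integral>\<^sup>+ x. e2ennreal ((?l x)\<^sup>2) \<partial>law_of p0) \<le> ennreal b"
    using kl2 \<open>0 \<le> b\<close> by (simp add: ext_integral_def enn2ereal_le_ereal_iff zero_ennreal.rep_eq)
  have "AE x in law_of p0. e2ennreal ((?l x)\<^sup>2) \<noteq> \<infinity>"
    using l2 by (intro nn_integral_noteq_infinite) (auto simp: top_unique)
  then have qpos: "AE x in law_of p0. 0 < q x"
  proof eventually_elim
    case (elim x)
    have "e2ennreal ((?l x)\<^sup>2) = \<infinity>" if "q x = 0"
      using that by (simp add: log_ratio_def power2_eq_square)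
    then show ?case using elim q'[of x] by fastforce
  qed
  moreover have "AE x in law_of p0. 0 < p0 x"
    unfolding law_of_def by (subst AE_density) auto
  ultimately show pos: "AE x in law_of p0. 0 < p0 x \<and> 0 < q x"
    by eventually_elim auto
  have "(\<integral>\<^sup>+ x. ennreal ((?g x)\<^sup>2) \<partial>law_of p0) = (\<integral>\<^sup>+ x. e2ennreal ((?l x)\<^sup>2) \<partial>law_of p0)"
    by (rule nn_integral_cong_AE, use qpos in eventually_elim) (simp add: log_ratio_def e2ennreal_ereal)
  with l2 have g2: "(\<integral>\<^sup>+ x. ennreal ((?g x)\<^sup>2) \<partial>law_of p0) \<le> ennreal b"
    by simp
  show int2: "integrable (law_of p0) (\<lambda>x. (?g x)\<^sup>2)"
    by (rule integrableI_bounded) (use g2 in \<open>auto simp: le_less_trans less_top[symmetric] top_unique\<close>)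
  have "ennreal (\<integral>x. (?g x)\<^sup>2 \<partial>law_of p0) \<le> ennreal b"
    using g2 by (subst (asm) nn_integral_eq_integral[OF int2]) auto
  then show "(\<integral>x. (?g x)\<^sup>2 \<partial>law_of p0) \<le> b"
    using \<open>0 \<le> b\<close> by simp
  have int1: "integrable (law_of p0) ?g"
    by (rule P.square_integrable_imp_integrable[OF _ int2]) measurable
  have a1: "(\<integral>\<^sup>+ x. e2ennreal (?l x) \<partial>law_of p0) = (\<integral>\<^sup>+ x. ennreal (?g x) \<partial>law_of p0)"
    by (rule nn_integral_cong_AE, use qpos in eventually_elim) (simp add: log_ratio_def e2ennreal_ereal)
  have a2: "(\<integral>\<^sup>+ x. e2ennreal (- ?l x) \<partial>law_of p0) = (\<integral>\<^sup>+ x. ennreal (- ?g x) \<partial>law_of p0)"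
    by (rule nn_integral_cong_AE, use qpos in eventually_elim) (simp add: log_ratio_def e2ennreal_ereal)
  have "(\<integral>\<^sup>+ x. ennreal (?g x) \<partial>law_of p0) \<noteq> \<top>" "(\<integral>\<^sup>+ x. ennreal (- ?g x) \<partial>law_of p0) \<noteq> \<top>"
    using int1 by (auto simp: real_integrable_def)
  then obtain u v where uv: "(\<integral>\<^sup>+ x. ennreal (?g x) \<partial>law_of p0) = ennreal u" "0 \<le> u"
      "(\<integral>\<^sup>+ x. ennreal (- ?g x) \<partial>law_of p0) = ennreal v" "0 \<le> v"
    by (cases "\<integral>\<^sup>+ x. ennreal (?g x) \<partial>law_of p0"; cases "\<integral>\<^sup>+ x. ennreal (- ?g x) \<partial>law_of p0") blast+
  have "(\<integral>x. ?g x \<partial>law_of p0) = u - v"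
    using real_lebesgue_integral_def[OF int1] uv by simp
  moreover have "ereal (u - v) \<le> ereal b"
    using kl1 uv by (simp add: ext_integral_def a1 a2 enn2ereal_ennreal)
  ultimately show "(\<integral>x. ?g x \<partial>law_of p0) \<le> b" by simp
qed

text \<open>Chebyshev's inequality. Under \<open>p0\<close> the variables \<open>ln (p0 / q)\<close>
  have mean and variance at most \<open>b\<close>. On the event their sum exceeds
  \<open>2 * n * b\<close>, hence exceeds its mean by at least \<open>n * b\<close>, and
  \<open>n * b / (n * b)\<^sup>2 = 1 / (n * b)\<close>.\<close>

lemma (in prob_space) likelihood_ratio_lower_tail:
  fixes X :: "nat \<Rightarrow> 'a \<Rightarrow> real"
  assumes indep: "indep_vars (\<lambda>_. borel) X {1..n}" and "1 \<le> n"
    and dist: "\<And>i. i \<in> {1..n} \<Longrightarrow> distributed M lborel (X i) (\<lambda>x. ennreal (p0 x))"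
    and p0: "is_density p0" and q: "is_density q" and "0 < b"
    and kl1: "ext_integral (law_of p0) (\<lambda>x. log_ratio (p0 x) (q x)) \<le> ereal b"
    and kl2: "ext_integral (law_of p0) (\<lambda>x. (log_ratio (p0 x) (q x))\<^sup>2) \<le> ereal b"
  shows "prob {\<omega> \<in> space M. (\<Prod>i=1..n. q (X i \<omega>) / p0 (X i \<omega>)) < exp (- 2 * real n * b)} \<le> 1 / (real n * b)"
proof -
  have [measurable]: "p0 \<in> borel_measurable borel" "q \<in> borel_measurable borel"
    using p0 q by (auto simp: is_density_def)
  have rv[measurable]: "random_variable borel (X i)" if "i \<in> {1..n}" for i
    using distributed_measurable[OF dist[OF that]] by simp
  interpret P: prob_space "law_of p0" by (rule prob_space_law_of[OF p0])
  note lr = log_ratio_moments[OF p0 q kl1 kl2]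
  let ?g = "\<lambda>x. ln (p0 x / q x)"
  define \<mu> where "\<mu> = (\<integral>x. ?g x \<partial>law_of p0)"
  have \<mu>: "\<mu> \<le> b" using lr(4) \<open>0 < b\<close> by (simp add: \<mu>_def)
  have int2: "integrable (law_of p0) (\<lambda>x. (?g x)\<^sup>2)" using lr(2) \<open>0 < b\<close> by simp
  have int1: "integrable (law_of p0) ?g"
    by (rule P.square_integrable_imp_integrable[OF _ int2]) measurable
  have eqY: "(?g x - \<mu>)\<^sup>2 = (?g x)\<^sup>2 - 2 * \<mu> * ?g x + \<mu>\<^sup>2" for x
    by (simp add: power2_eq_square algebra_simps)
  have intY: "integrable (law_of p0) (\<lambda>x. (?g x - \<mu>)\<^sup>2)"
    unfolding eqY using int1 int2 by simp
  have "(\<integral>x. (?g x - \<mu>)\<^sup>2 \<partial>law_of p0) = (\<integral>x. (?g x)\<^sup>2 \<partial>law_of p0) - \<mu>\<^sup>2"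
    unfolding \<mu>_def by (rule P.variance_eq[OF int1 int2])
  then have varY: "(\<integral>x. (?g x - \<mu>)\<^sup>2 \<partial>law_of p0) \<le> b"
    using lr(3) \<open>0 < b\<close> zero_le_power2[of \<mu>] by linarith
  have trans: "expectation (\<lambda>\<omega>. f (X i \<omega>)) = (\<integral>x. f x \<partial>law_of p0)"
    "integrable (law_of p0) f \<Longrightarrow> integrable M (\<lambda>\<omega>. f (X i \<omega>))"
    if "i \<in> {1..n}" and [measurable]: "f \<in> borel_measurable borel" for i and f :: "real \<Rightarrow> real"
    using that(1) unfolding distr_eq_law_of[OF dist[OF that(1)], symmetric]
    by (simp_all add: integral_distr integrable_distr_eq)
  let ?Y = "\<lambda>i \<omega>. ?g (X i \<omega>) - \<mu>"
  let ?S = "\<lambda>\<omega>. \<Sum>i=1..n. ?Y i \<omega>"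
  have indY: "indep_vars (\<lambda>_. borel) ?Y {1..n}"
    by (rule indep_vars_compose2[OF indep, where Y = "\<lambda>_ x. ?g x - \<mu>"]) measurable
  have Y2: "expectation (\<lambda>\<omega>. (?Y i \<omega>)\<^sup>2) \<le> b" "integrable M (\<lambda>\<omega>. (?Y i \<omega>)\<^sup>2)"
    "expectation (?Y i) = 0" if "i \<in> {1..n}" for i
    using trans[OF that, of "\<lambda>x. (?g x - \<mu>)\<^sup>2"] trans[OF that, of "\<lambda>x. ?g x - \<mu>"] varY intY int1
    by (simp_all add: \<mu>_def P.prob_space[simplified])
  have S: "integrable M (\<lambda>\<omega>. (?S \<omega>)\<^sup>2)"
    "expectation (\<lambda>\<omega>. (?S \<omega>)\<^sup>2) = (\<Sum>i=1..n. expectation (\<lambda>\<omega>. (?Y i \<omega>)\<^sup>2))"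
    using sum_indep_second_moment[OF _ indY] Y2(2,3) by auto
  have ES: "expectation (\<lambda>\<omega>. (?S \<omega>)\<^sup>2) \<le> real n * b"
    unfolding S(2) using sum_mono[of "{1..n}" "\<lambda>i. expectation (\<lambda>\<omega>. (?Y i \<omega>)\<^sup>2)" "\<lambda>_. b"] Y2(1) by simp
  have Sm[measurable]: "random_variable borel ?S" by measurable
  have nb: "0 < real n * b" using \<open>1 \<le> n\<close> \<open>0 < b\<close> by simp
  \<comment> \<open>Almost surely both densities are positive at all data points; there the
    likelihood ratio is the exponential of minus the sum of the logarithms. Elsewhere
    \<open>ln\<close> and division may take default values.\<close>
  have "AE \<omega> in M. 0 < p0 (X i \<omega>) \<and> 0 < q (X i \<omega>)" if i: "i \<in> {1..n}" for i
  proof -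
    have "AE x in distr M borel (X i). 0 < p0 x \<and> 0 < q x"
      unfolding distr_eq_law_of[OF dist[OF i]] using lr(1) \<open>0 < b\<close> by simp
    then show ?thesis
      by (subst (asm) AE_distr_iff) (use rv[OF i] in measurable)
  qed
  then have "AE \<omega> in M. \<forall>i\<in>{1..n}. 0 < p0 (X i \<omega>) \<and> 0 < q (X i \<omega>)"
    by (intro AE_finite_allI) auto
  then have "prob {\<omega> \<in> space M. (\<Prod>i=1..n. q (X i \<omega>) / p0 (X i \<omega>)) < exp (- 2 * real n * b)}
      \<le> prob {\<omega> \<in> space M. (real n * b)\<^sup>2 \<le> (?S \<omega>)\<^sup>2}"
  proof (intro finite_measure_mono_AE, eventually_elim, safe)
    fix \<omega> assume pos: "\<forall>i\<in>{1..n}. 0 < p0 (X i \<omega>) \<and> 0 < q (X i \<omega>)"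
      and small: "(\<Prod>i=1..n. q (X i \<omega>) / p0 (X i \<omega>)) < exp (- 2 * real n * b)"
    have "exp (- (\<Sum>i=1..n. ?g (X i \<omega>))) = (\<Prod>i=1..n. q (X i \<omega>) / p0 (X i \<omega>))"
      unfolding sum_negf[symmetric] exp_sum[OF finite_atLeastAtMost]
      using pos by (intro prod.cong refl) (simp add: exp_minus)
    with small have "exp (- (\<Sum>i=1..n. ?g (X i \<omega>))) < exp (- 2 * real n * b)"
      by (simp only:)
    then have "2 * real n * b < (\<Sum>i=1..n. ?g (X i \<omega>))"
      by (simp only: exp_less_cancel_iff)
    then have "real n * b \<le> ?S \<omega>"
      using mult_left_mono[OF \<mu>, of "real n"] by (simp add: sum_subtractf)
    then show "(real n * b)\<^sup>2 \<le> (?S \<omega>)\<^sup>2"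
      using nb by (intro power_mono) auto
  qed measurable
  also have "\<dots> \<le> expectation (\<lambda>\<omega>. (?S \<omega>)\<^sup>2) / (real n * b)\<^sup>2"
    by (rule integral_Markov_inequality_measure[where A = "space M"]) (use S(1) nb \<open>1 \<le> n\<close> in auto)
  also have "\<dots> \<le> real n * b / (real n * b)\<^sup>2"
    by (intro divide_right_mono ES) auto
  also have "\<dots> = 1 / (real n * b)"
    using nb by (simp add: power2_eq_square)
  finally show ?thesis .
qed

text \<open>Call \<open>q\<close> in \<open>A\<close> bad for \<open>\<omega>\<close> if
  \<open>W \<omega> q < t\<close>. By Fubini's theorem the expected mass of the bad \<open>q\<close>
  is at most \<open>\<beta>\<close> times the mass of \<open>A\<close>. By Markov's inequality at
  least half of \<open>A\<close> is bad with probability at most \<open>2 * \<beta>\<close>;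
  otherwise more than half of \<open>A\<close> contributes at least \<open>t\<close>, whence the
  factor \<open>1 / 2\<close> in the threshold.\<close>

lemma (in prob_space) integral_lower_tail:
  fixes N :: "'b measure" and W :: "'a \<Rightarrow> 'b \<Rightarrow> real"
  assumes W[measurable]: "(\<lambda>(\<omega>, q). W \<omega> q) \<in> borel_measurable (M \<Otimes>\<^sub>M N)" and "finite_measure N"
    and A[measurable]: "A \<in> sets N" and "0 < t" "0 \<le> \<beta>"
    and tail: "\<And>q. q \<in> A \<Longrightarrow> prob {\<omega> \<in> space M. W \<omega> q < t} \<le> \<beta>"
  shows "prob {\<omega> \<in> space M. (\<integral>\<^sup>+ q. ennreal (W \<omega> q) \<partial>N) < ennreal (t * measure N A / 2)} \<le> 2 * \<beta>"
proof (cases "measure N A = 0")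
  case True
  \<comment> \<open>The threshold is 0 here, and no integral lies below it.\<close>
  then show ?thesis using \<open>0 \<le> \<beta>\<close> by simp
next
  case False
  interpret N: finite_measure N by fact
  interpret pair_sigma_finite M N ..
  define a where "a = measure N A"
  have a: "0 < a" "emeasure N A = ennreal a"
    using False by (auto simp: a_def N.emeasure_eq_measure zero_less_measure_iff)
  let ?I = "\<lambda>\<omega> q. indicator {r \<in> space N. r \<in> A \<and> W \<omega> r < t} q :: ennreal"
  let ?\<phi> = "\<lambda>\<omega>. \<integral>\<^sup>+ q. ?I \<omega> q \<partial>N"
  have Im[measurable]: "(\<lambda>(\<omega>, q). ?I \<omega> q) \<in> borel_measurable (M \<Otimes>\<^sub>M N)"
  proof -
    have "(\<lambda>(\<omega>, q). ?I \<omega> q) = (\<lambda>(\<omega>, q). if q \<in> space N \<and> q \<in> A \<and> W \<omega> q < t then 1 else 0)"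
      by (auto simp: fun_eq_iff indicator_def)
    also have "\<dots> \<in> borel_measurable (M \<Otimes>\<^sub>M N)" by measurable
    finally show ?thesis .
  qed
  have E\<phi>: "(\<integral>\<^sup>+ \<omega>. ?\<phi> \<omega> \<partial>M) \<le> ennreal (\<beta> * a)"
  proof -
    have "(\<integral>\<^sup>+ \<omega>. ?\<phi> \<omega> \<partial>M) = (\<integral>\<^sup>+ q. (\<integral>\<^sup>+ \<omega>. ?I \<omega> q \<partial>M) \<partial>N)"
      by (rule Fubini'[symmetric]) (rule Im)
    also have "\<dots> \<le> (\<integral>\<^sup>+ q. ennreal \<beta> * indicator A q \<partial>N)"
    proof (rule nn_integral_mono)
      fix q assume q: "q \<in> space N"
      have "(\<integral>\<^sup>+ \<omega>. ?I \<omega> q \<partial>M) \<le> ennreal \<beta>" if "q \<in> A"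
      proof -
        have "(\<integral>\<^sup>+ \<omega>. ?I \<omega> q \<partial>M) = (\<integral>\<^sup>+ \<omega>. indicator {\<omega> \<in> space M. W \<omega> q < t} \<omega> \<partial>M)"
          using q that by (intro nn_integral_cong) (auto simp: indicator_def)
        also have "\<dots> = ennreal (prob {\<omega> \<in> space M. W \<omega> q < t})"
          using measurable_Pair1[OF W q] by (subst nn_integral_indicator) (auto simp: emeasure_eq_measure)
        also have "\<dots> \<le> ennreal \<beta>"
          by (intro ennreal_leI tail that)
        finally show ?thesis .
      qed
      then show "(\<integral>\<^sup>+ \<omega>. ?I \<omega> q \<partial>M) \<le> ennreal \<beta> * indicator A q"
        by (cases "q \<in> A") (auto simp: indicator_def)
    qed
    also have "\<dots> = ennreal (\<beta> * a)"
      using \<open>0 \<le> \<beta>\<close> a by (simp add: nn_integral_cmult_indicator ennreal_mult)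
    finally show ?thesis .
  qed
  have "emeasure M {\<omega> \<in> space M. (\<integral>\<^sup>+ q. ennreal (W \<omega> q) \<partial>N) < ennreal (t * a / 2)}
      \<le> emeasure M {\<omega> \<in> space M. 1 \<le> ennreal (2 / a) * ?\<phi> \<omega>}"
  proof (rule emeasure_mono, safe)
    fix \<omega> assume \<omega>: "\<omega> \<in> space M" and small: "(\<integral>\<^sup>+ q. ennreal (W \<omega> q) \<partial>N) < ennreal (t * a / 2)"
    have [measurable]: "W \<omega> \<in> borel_measurable N" "?I \<omega> \<in> borel_measurable N"
      using measurable_Pair2[OF W \<omega>] measurable_Pair2[OF Im \<omega>] by simp_all
    have "ennreal (t * a) = (\<integral>\<^sup>+ q. ennreal t * indicator A q \<partial>N)"
      using \<open>0 < t\<close> a by (simp add: nn_integral_cmult_indicator ennreal_mult)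
    \<comment> \<open>On \<open>A\<close>, either \<open>W \<omega> q\<close> is at least
      \<open>t\<close>, or \<open>q\<close> is bad and the second term equals
      \<open>t\<close>.\<close>
    also have "\<dots> \<le> (\<integral>\<^sup>+ q. ennreal (W \<omega> q) + ennreal t * ?I \<omega> q \<partial>N)"
      by (intro nn_integral_mono) (auto simp: indicator_def ennreal_leI)
    also have "\<dots> = (\<integral>\<^sup>+ q. ennreal (W \<omega> q) \<partial>N) + ennreal t * ?\<phi> \<omega>"
      by (subst nn_integral_add) (auto simp: nn_integral_cmult)
    also have "\<dots> \<le> ennreal (t * a / 2) + ennreal t * ?\<phi> \<omega>"
      using small by (intro add_right_mono) auto
    finally have *: "ennreal (t * a) \<le> ennreal (t * a / 2) + ennreal t * ?\<phi> \<omega>" .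
    show "1 \<le> ennreal (2 / a) * ?\<phi> \<omega>"
    proof (cases "?\<phi> \<omega>")
      case (real r)
      then have "t * a \<le> t * a / 2 + t * r"
        using * \<open>0 < t\<close> a by (simp flip: ennreal_mult ennreal_plus)
      then have "t * (a / 2) \<le> t * r" by simp
      then have "1 \<le> 2 / a * r" using \<open>0 < t\<close> a by (simp add: field_simps)
      then show ?thesis using real a by (simp flip: ennreal_mult)
    next
      case top
      then show ?thesis using a by (simp add: ennreal_mult_top)
    qed
  qed measurable
  also have "\<dots> \<le> ennreal (2 / a) * (\<integral>\<^sup>+ \<omega>. ?\<phi> \<omega> * indicator (space M) \<omega> \<partial>M)"
    by (rule nn_integral_Markov_inequality) measurable
  also have "(\<integral>\<^sup>+ \<omega>. ?\<phi> \<omega> * indicator (space M) \<omega> \<partial>M) = (\<integral>\<^sup>+ \<omega>. ?\<phi> \<omega> \<partial>M)"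
    by (intro nn_integral_cong) (simp add: indicator_def)
  also have "ennreal (2 / a) * \<dots> \<le> ennreal (2 / a) * ennreal (\<beta> * a)"
    by (intro mult_left_mono E\<phi>) auto
  also have "\<dots> = ennreal (2 * \<beta>)"
    using a \<open>0 \<le> \<beta>\<close> by (simp flip: ennreal_mult)
  finally show ?thesis
    using \<open>0 \<le> \<beta>\<close> by (simp add: emeasure_eq_measure a_def)
qed

section \<open>Numerator over a set of densities and the posterior quotient\<close>

text \<open>\<open>likelihood_integral_tail\<close> for the prior cut down to \<open>A\<close>,
  whose mass is at most 1.\<close>

lemma (in prob_space) restricted_likelihood_integral_tail:
  fixes X :: "nat \<Rightarrow> 'a \<Rightarrow> real" and N :: "'b measure" and k :: "'b \<Rightarrow> real \<Rightarrow> real" and h p0 :: "real \<Rightarrow> real"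
  assumes indep: "indep_vars (\<lambda>_. borel) X {1..n}" and "1 \<le> n"
    and dist: "\<And>i. i \<in> {1..n} \<Longrightarrow> distributed M lborel (X i) (\<lambda>x. ennreal (p0 x))"
    and k: "(\<lambda>(q, x). k q x) \<in> borel_measurable (N \<Otimes>\<^sub>M borel)" and N: "prob_space N"
    and dens: "\<And>q. q \<in> space N \<Longrightarrow> is_density (k q)" and p0: "is_density p0"
    and h: "h \<in> borel_measurable borel" and h0: "\<And>x. 0 \<le> h x"
    and A: "A \<in> sets N"
    and k2: "\<And>q. q \<in> A \<Longrightarrow> (\<integral>\<^sup>+ x. ennreal ((h x)\<^sup>2 * k q x) \<partial>lborel) \<le> ennreal K"
    and p2: "(\<integral>\<^sup>+ x. ennreal ((h x)\<^sup>2 * p0 x) \<partial>lborel) \<le> ennreal K"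
    and "0 < K" "0 < \<delta>"
    and sep: "(\<forall>q\<in>A. (\<integral>\<^sup>+ x. ennreal (h x * k q x) \<partial>lborel) + ennreal \<delta>
                 \<le> (\<integral>\<^sup>+ x. ennreal (h x * p0 x) \<partial>lborel)) \<or>
              (\<forall>q\<in>A. (\<integral>\<^sup>+ x. ennreal (h x * p0 x) \<partial>lborel) + ennreal \<delta>
                 \<le> (\<integral>\<^sup>+ x. ennreal (h x * k q x) \<partial>lborel))"
    and "0 < s"
  shows "prob {\<omega> \<in> space M. ennreal s \<le> (\<integral>\<^sup>+ q\<in>A. ennreal (\<Prod>i=1..n. k q (X i \<omega>) / p0 (X i \<omega>)) \<partial>N)}
           \<le> exp (- \<delta>\<^sup>2 / (8 * K)) ^ n / sqrt s"
proof -
  interpret N: prob_space N by fact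
  note [measurable] = A
  \<comment> \<open>An indicator density keeps the sigma-algebra of \<open>N\<close>, so that joint
    measurability of the kernel carries over, and it turns constraints on \<open>A\<close> into
    constraints almost everywhere.\<close>
  let ?D = "density N (indicator A)"
  note measurable_kernel_comp[OF k, measurable (raw)]
  have AE: "AE q in ?D. P q" if "\<And>q. q \<in> A \<Longrightarrow> P q" for P
    using that by (subst AE_density) (auto simp: indicator_def)
  have eD: "emeasure ?D (space ?D) = emeasure N A"
    using sets.sets_into_space[OF A] by (subst emeasure_density) (auto simp: Int_absorb2 Int_absorb1 simp flip: indicator_inter_arith)
  have "(\<integral>\<^sup>+ q. ennreal (\<Prod>i=1..n. k q (X i \<omega>) / p0 (X i \<omega>)) \<partial>?D)
      = (\<integral>\<^sup>+ q\<in>A. ennreal (\<Prod>i=1..n. k q (X i \<omega>) / p0 (X i \<omega>)) \<partial>N)" if "\<omega> \<in> space M" for \<omega>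
    by (subst nn_integral_density) (auto simp: mult.commute)
  then have "{\<omega> \<in> space M. ennreal s \<le> (\<integral>\<^sup>+ q\<in>A. ennreal (\<Prod>i=1..n. k q (X i \<omega>) / p0 (X i \<omega>)) \<partial>N)}
      = {\<omega> \<in> space M. ennreal s \<le> (\<integral>\<^sup>+ q. ennreal (\<Prod>i=1..n. k q (X i \<omega>) / p0 (X i \<omega>)) \<partial>?D)}"
    by auto
  also have "emeasure M \<dots> \<le> ennreal (exp (- \<delta>\<^sup>2 / (8 * K)) ^ n / sqrt s) * esqrt (emeasure ?D (space ?D))"
  proof (rule likelihood_integral_tail[where h = h])
    show "(\<lambda>(q, x). k q x) \<in> borel_measurable (?D \<Otimes>\<^sub>M borel)"
      using k by (simp cong: measurable_cong_sets sets_pair_measure_cong)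
    show "finite_measure ?D"
      by (rule finite_measureI) (simp only: eD, simp)
    show "AE q in ?D. (\<integral>\<^sup>+ x. ennreal ((h x)\<^sup>2 * k q x) \<partial>lborel) \<le> ennreal K"
      by (rule AE) (rule k2)
    show "(AE q in ?D. (\<integral>\<^sup>+ x. ennreal (h x * k q x) \<partial>lborel) + ennreal \<delta>
               \<le> (\<integral>\<^sup>+ x. ennreal (h x * p0 x) \<partial>lborel)) \<or>
          (AE q in ?D. (\<integral>\<^sup>+ x. ennreal (h x * p0 x) \<partial>lborel) + ennreal \<delta>
               \<le> (\<integral>\<^sup>+ x. ennreal (h x * k q x) \<partial>lborel))"
      using sep by (rule disj_forward) (rule AE, blast)+
  qed (use assms in auto)
  also have "\<dots> \<le> ennreal (exp (- \<delta>\<^sup>2 / (8 * K)) ^ n / sqrt s) * esqrt 1"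
    unfolding eD by (intro mult_left_mono esqrt_mono N.emeasure_le_1) auto
  also have "esqrt 1 = 1"
    using esqrt_ennreal[of 1] by simp
  finally show ?thesis
    using \<open>0 < s\<close> by (simp add: emeasure_eq_measure)
qed

text \<open>The numerator over \<open>B\<close> is at most the sum of the numerators over the three
  sets. The one over \<open>C\<close> is kept as a posterior probability; the other two are at most
  \<open>s\<close> each, against a denominator of at least \<open>d\<close>.\<close>

lemma posterior_le:
  fixes N :: "(real \<Rightarrow> real) measure"
  assumes meas: "(\<lambda>q. ennreal (\<Prod>i=1..n. q (x i) / p0 (x i))) \<in> borel_measurable N"
    and [measurable]: "C \<in> sets N" "A1 \<in> sets N" "A2 \<in> sets N"
    and sub: "B \<subseteq> C \<union> A1 \<union> A2"
    and A1: "(\<integral>\<^sup>+ q\<in>A1. ennreal (\<Prod>i=1..n. q (x i) / p0 (x i)) \<partial>N) \<le> ennreal s"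
    and A2: "(\<integral>\<^sup>+ q\<in>A2. ennreal (\<Prod>i=1..n. q (x i) / p0 (x i)) \<partial>N) \<le> ennreal s"
    and D: "ennreal d \<le> (\<integral>\<^sup>+ q. ennreal (\<Prod>i=1..n. q (x i) / p0 (x i)) \<partial>N)"
    and "0 \<le> s" "0 < d"
  shows "posterior N p0 n x B \<le> posterior N p0 n x C + 2 * s / d"
proof -
  define W where "W q = ennreal (\<Prod>i=1..n. q (x i) / p0 (x i))" for q :: "real \<Rightarrow> real"
  have [measurable]: "W \<in> borel_measurable N"
    using meas by (simp add: W_def[abs_def])
  define I where "I A = (\<integral>\<^sup>+ q\<in>A. W q \<partial>N)" for A
  define T where "T = (\<integral>\<^sup>+ q. W q \<partial>N)"
  have post: "posterior N p0 n x A = enn2real (I A / T)" for A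
    by (simp add: posterior_def I_def T_def W_def)
  have IT: "I A \<le> T" for A
    unfolding I_def T_def by (intro nn_integral_mono) (auto simp: indicator_def)
  have "I B \<le> (\<integral>\<^sup>+ q. W q * indicator C q + (W q * indicator A1 q + W q * indicator A2 q) \<partial>N)"
    unfolding I_def using sub by (intro nn_integral_mono) (auto simp: indicator_def)
  also have "\<dots> = I C + (I A1 + I A2)"
    unfolding I_def by (simp add: nn_integral_add)
  also have "\<dots> \<le> I C + (ennreal s + ennreal s)"
    using A1 A2 unfolding I_def W_def by (intro add_mono) auto
  finally have IB: "I B \<le> I C + ennreal (2 * s)"
    using \<open>0 \<le> s\<close> by (simp flip: ennreal_plus)
  show ?thesis
  proof (cases T)
    \<comment> \<open>With an infinite normalising integral the posterior is 0 for every
      set.\<close>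
    case top
    then show ?thesis
      using \<open>0 \<le> s\<close> \<open>0 < d\<close> by (simp add: post ennreal_divide_top)
  next
    case (real r)
    then have "I B \<noteq> \<top>" "I C \<noteq> \<top>"
      using IT[of B] IT[of C] by (auto simp: top_unique)
    then obtain b c where bc: "I B = ennreal b" "0 \<le> b" "I C = ennreal c" "0 \<le> c"
      by (cases "I B"; cases "I C") blast+
    have "ennreal d \<le> T"
      using D by (simp only: T_def W_def)
    then have "d \<le> r"
      using real by simp
    have "b \<le> c + 2 * s"
      using IB bc \<open>0 \<le> s\<close> by (simp flip: ennreal_plus)
    then have "b / r \<le> (c + 2 * s) / r"
      using \<open>d \<le> r\<close> \<open>0 < d\<close> by (intro divide_right_mono) auto
    also have "\<dots> \<le> c / r + 2 * s / d"
      using \<open>d \<le> r\<close> \<open>0 < d\<close> \<open>0 \<le> s\<close> by (simp add: add_divide_distrib divide_left_mono)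
    finally show ?thesis
      using bc real \<open>d \<le> r\<close> \<open>0 < d\<close> by (simp add: post divide_ennreal)
  qed
qed

section \<open>Moments in the extended reals\<close>

lemma abs_moment_law_of:
  assumes "is_density q"
  shows "abs_moment r (law_of q) = enn2ereal (\<integral>\<^sup>+ x. ennreal (\<bar>x\<bar> powr r * q x) \<partial>lborel)"
proof -
  have "q \<in> borel_measurable borel" and "\<And>x. 0 \<le> q x"
    using assms by (auto simp: is_density_def)
  then show ?thesis
    by (simp add: abs_moment_def nn_integral_law_of ennreal_mult mult.commute)
qed

text \<open>Separation is expressed by sums, since subtraction in \<open>ennreal\<close> truncates
  at 0. An infinite \<open>a\<close> falls under the second alternative.\<close>

lemma enn2ereal_abs_diff_gt_cases:
  fixes a b :: ennreal
  assumes "\<bar>enn2ereal a - enn2ereal b\<bar> > ereal d" and "0 \<le> d" and "b \<noteq> \<infinity>"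
  shows "a + ennreal d \<le> b \<or> b + ennreal d \<le> a"
proof (cases b)
  case (real y)
  show ?thesis
  proof (cases a)
    case (real x)
    with assms \<open>b = ennreal y\<close> \<open>0 \<le> y\<close> have "d < \<bar>x - y\<bar>"
      by (simp add: enn2ereal_ennreal)
    then show ?thesis
      using real \<open>b = ennreal y\<close> \<open>0 \<le> y\<close> \<open>0 \<le> d\<close> by (auto simp flip: ennreal_plus simp: abs_if split: if_splits)
  qed simp
qed (use assms in simp)

section \<open>Concentration of the moment under the posterior\<close>

theorem theorem3p1:
  fixes M :: "'a measure"
    and X :: "nat \<Rightarrow> 'a \<Rightarrow> real"
    and p0 :: "real \<Rightarrow> real"
    and F :: "(real \<Rightarrow> real) set"
    and \<pi> :: "nat \<Rightarrow> (real \<Rightarrow> real) measure"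
    and \<epsilon> :: "nat \<Rightarrow> real"
    and p K :: real
  assumes "prob_space M"
    and "is_density p0"
    and "prob_space.indep_vars M (\<lambda>_. borel) X {1..}"
    and "\<And>i. i \<ge> 1 \<Longrightarrow> distributed M lborel (X i) (\<lambda>x. ennreal (p0 x))"
    and "density_family F"
    and "\<And>n. is_prior F (\<pi> n)"
    and "p \<ge> 1"
    and "\<And>n. \<epsilon> n > 0"
    and "\<epsilon> \<longlonglongrightarrow> 0"
    and "filterlim (\<lambda>n. real n * (\<epsilon> n)\<^sup>2) at_top sequentially"
    and "\<forall>\<^sub>F n in sequentially. measure (\<pi> n) (KL_nbhd F p0 (\<epsilon> n)) \<ge> exp (- real n * (\<epsilon> n)\<^sup>2)"
    and "abs_moment (2 * p) (law_of p0) \<le> ereal K"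
    and "tendsto_in_prob M
           (\<lambda>n \<omega>. posterior (\<pi> n) p0 n (\<lambda>i. X i \<omega>)
              {q \<in> F. abs_moment (2 * p) (law_of q) > ereal K}) 0"
  shows "\<exists>K'>0. tendsto_in_prob M
           (\<lambda>n \<omega>. posterior (\<pi> n) p0 n (\<lambda>i. X i \<omega>)
              {q \<in> F. \<bar>abs_moment p (law_of q) - abs_moment p (law_of p0)\<bar> > ereal (K' * \<epsilon> n)}) 0"
proof -
  interpret prob_space M by fact
  note p0 = \<open>is_density p0\<close>
  have p0m[measurable]: "p0 \<in> borel_measurable borel" and p0': "\<And>x. 0 \<le> p0 x"
    using p0 by (auto simp: is_density_def)
  have dist: "distributed M lborel (X i) (\<lambda>x. ennreal (p0 x))" if "i \<in> {1..n}" for i n :: nat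
    using assms(4) that by simp
  have indep: "indep_vars (\<lambda>_. borel) X {1..n}" for n :: nat
    by (rule indep_vars_subset[OF assms(3)]) auto
  have dens: "is_density q" if "q \<in> F" for q
    using assms(5) that by (simp add: density_family_def)
  have sets_\<pi>: "sets (\<pi> n) = sets (weak_borel F)" and prob_\<pi>: "prob_space (\<pi> n)" for n
    using assms(6)[of n] by (auto simp: is_prior_def)
  have space_\<pi>: "space (\<pi> n) = F" for n
    using sets_eq_imp_space_eq[OF sets_\<pi>[of n]] by (simp add: weak_borel_def space_measure_of_conv)
  \<comment> \<open>The kernel \<open>k\<close> of the lemmas is evaluation here: the index is the
    density itself.\<close>
  have kern: "(\<lambda>(q, x). q x) \<in> borel_measurable (\<pi> n \<Otimes>\<^sub>M borel)" for n
    using assms(5) sets_\<pi>[of n] unfolding density_family_def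
    by (simp cong: measurable_cong_sets sets_pair_measure_cong)
  define m where "m r q = (\<integral>\<^sup>+ x. ennreal (\<bar>x\<bar> powr r * q x) \<partial>lborel)" for r and q :: "real \<Rightarrow> real"
  have m: "abs_moment r (law_of q) = enn2ereal (m r q)" if "is_density q" for r q
    using abs_moment_law_of[OF that] by (simp add: m_def)
  have m_meas: "m r \<in> borel_measurable (\<pi> n)" for r n
    unfolding m_def using kern[of n]
    by (intro lborel.borel_measurable_nn_integral) (simp cong: measurable_cong_sets sets_pair_measure_cong)
  have "enn2ereal (m (2 * p) p0) \<le> ereal K"
    using assms(12) by (simp add: m[OF p0])
  then have "0 \<le> K"
    using enn2ereal_nonneg[of "m (2 * p) p0"] order_trans zero_ereal_def by (metis ereal_less_eq(3))
  then have mp0: "m (2 * p) p0 \<le> ennreal K"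
    using \<open>enn2ereal (m (2 * p) p0) \<le> ereal K\<close> by (simp add: enn2ereal_le_ereal_iff)
  \<comment> \<open>The moment bound appears as a divisor; adding 1 makes it positive.\<close>
  define K1 where "K1 = K + 1"
  have "0 < K1" "K \<le> K1" using \<open>0 \<le> K\<close> by (auto simp: K1_def)
  define h :: "real \<Rightarrow> real" where "h x = \<bar>x\<bar> powr p" for x
  have h[measurable]: "h \<in> borel_measurable borel" and h0: "\<And>x. 0 \<le> h x"
    by (auto simp: h_def[abs_def])
  have h2: "(h x)\<^sup>2 = \<bar>x\<bar> powr (2 * p)" for x
    using powr_add[of "\<bar>x\<bar>" p p] by (simp add: h_def power2_eq_square)
  \<comment> \<open>A finite true moment keeps the difference of moments free of infinity minus
    infinity.\<close>
  have mp_fin: "m p p0 \<noteq> \<infinity>"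
  proof -
    have "m p p0 \<le> (\<integral>\<^sup>+ x. ennreal (p0 x) + ennreal (\<bar>x\<bar> powr (2 * p) * p0 x) \<partial>lborel)"
      unfolding m_def
    proof (rule nn_integral_mono)
      fix x :: real
      have "h x \<le> 1 + (h x)\<^sup>2"
        using sum_squares_ge_zero[of "h x - 1" "h x"] h0[of x] by (simp add: power2_eq_square algebra_simps)
      then have "h x * p0 x \<le> (1 + (h x)\<^sup>2) * p0 x"
        by (rule mult_right_mono) (rule p0')
      then have "\<bar>x\<bar> powr p * p0 x \<le> p0 x + \<bar>x\<bar> powr (2 * p) * p0 x"
        unfolding distrib_right h2 unfolding h_def by simp
      then show "ennreal (\<bar>x\<bar> powr p * p0 x) \<le> ennreal (p0 x) + ennreal (\<bar>x\<bar> powr (2 * p) * p0 x)"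
        using p0'[of x] by (simp flip: ennreal_plus add: ennreal_leI)
    qed
    also have "\<dots> = 1 + m (2 * p) p0"
      using p0 by (simp add: nn_integral_add m_def is_density_def)
    also have "\<dots> \<le> 1 + ennreal K"
      using mp0 by (intro add_left_mono)
    also have "\<dots> < \<infinity>" by simp
    finally show ?thesis by simp
  qed
  \<comment> \<open>With \<open>v n = n * (\<epsilon> n)\<^sup>2\<close>, the affinity bound to the
    power \<open>n\<close> becomes \<open>exp (- (25 / 8) * v n)\<close>. The numerator is compared
    with \<open>exp (- 4 * v n)\<close>, which is negligible against a denominator of order
    \<open>exp (- 3 * v n)\<close>, and the square root in Markov's inequality then costs a factor
    \<open>exp (2 * v n)\<close>. The constant 5 leaves the exponent
    \<open>25 / 8 - 2 = 9 / 8\<close>, which is at least 1.\<close>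
  define K' where "K' = 5 * sqrt K1"
  have "0 < K'" using \<open>0 < K1\<close> by (simp add: K'_def)
  define C where "C = {q \<in> F. abs_moment (2 * p) (law_of q) > ereal K}"
  define B where "B n = {q \<in> F. \<bar>abs_moment p (law_of q) - abs_moment p (law_of p0)\<bar> > ereal (K' * \<epsilon> n)}" for n
  define A1 where "A1 n = {q \<in> F. m (2 * p) q \<le> ennreal K \<and> m p q + ennreal (K' * \<epsilon> n) \<le> m p p0}" for n
  define A2 where "A2 n = {q \<in> F. m (2 * p) q \<le> ennreal K \<and> m p p0 + ennreal (K' * \<epsilon> n) \<le> m p q}" for n
  have C_eq: "C = {q \<in> F. \<not> m (2 * p) q \<le> ennreal K}"
    using \<open>0 \<le> K\<close> by (auto simp: C_def m dens not_le[symmetric] enn2ereal_le_ereal_iff)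
  have sets: "C \<in> sets (\<pi> n)" "A1 n \<in> sets (\<pi> n)" "A2 n \<in> sets (\<pi> n)" for n
  proof -
    note [measurable] = m_meas[of _ n]
    show "C \<in> sets (\<pi> n)" "A1 n \<in> sets (\<pi> n)" "A2 n \<in> sets (\<pi> n)"
      unfolding C_eq A1_def A2_def space_\<pi>[of n, symmetric] by measurable
  qed
  \<comment> \<open>Outside \<open>C\<close> a large deviation of the moment has one of two signs,
    and \<open>A1 n\<close>, \<open>A2 n\<close> each fix one sign, as mixing demands.\<close>
  have sub: "B n \<subseteq> C \<union> A1 n \<union> A2 n" for n
  proof
    fix q assume "q \<in> B n"
    then have "q \<in> F" and "\<bar>enn2ereal (m p q) - enn2ereal (m p p0)\<bar> > ereal (K' * \<epsilon> n)"
      by (auto simp: B_def m dens p0)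
    then show "q \<in> C \<union> A1 n \<union> A2 n"
      using enn2ereal_abs_diff_gt_cases[of "K' * \<epsilon> n" "m p q" "m p p0"] mp_fin \<open>0 < K'\<close> assms(8)[of n]
      by (auto simp: C_eq A1_def A2_def)
  qed
  define v where "v n = real n * (\<epsilon> n)\<^sup>2" for n
  have v: "filterlim v at_top sequentially"
    using assms(10) by (simp add: v_def[abs_def])
  let ?W = "\<lambda>n \<omega> q. \<Prod>i=1..n. q (X i \<omega>) / p0 (X i \<omega>)"
  let ?I = "\<lambda>n \<omega> A. \<integral>\<^sup>+ q\<in>A. ennreal (?W n \<omega> q) \<partial>\<pi> n"
  let ?T = "\<lambda>n \<omega>. \<integral>\<^sup>+ q. ennreal (?W n \<omega> q) \<partial>\<pi> n"
  have Wm: "(\<lambda>(\<omega>, q). ?W n \<omega> q) \<in> borel_measurable (M \<Otimes>\<^sub>M \<pi> n)" for n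
  proof -
    note measurable_kernel_comp[OF kern[of n], measurable (raw)]
    have [measurable]: "random_variable borel (X i)" if "i \<in> {1..n}" for i
      using distributed_measurable[OF dist[OF that]] by simp
    show ?thesis by measurable
  qed
  have Wq: "(\<lambda>q. ennreal (?W n \<omega> q)) \<in> borel_measurable (\<pi> n)" if "\<omega> \<in> space M" for n \<omega>
    using measurable_Pair2[OF Wm that] by simp
  have Im: "(\<lambda>\<omega>. ?I n \<omega> A) \<in> borel_measurable M" if [measurable]: "A \<in> sets (\<pi> n)" for n A
  proof -
    interpret \<pi>: prob_space "\<pi> n" by (rule prob_\<pi>)
    note Wm[of n, measurable]
    show ?thesis by measurable
  qed
  have Tm: "?T n \<in> borel_measurable M" for n
  proof -
    interpret \<pi>: prob_space "\<pi> n" by (rule prob_\<pi>)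
    note Wm[of n, measurable]
    show ?thesis by measurable
  qed
  have num: "prob {\<omega> \<in> space M. ennreal (exp (- 4 * v n)) \<le> ?I n \<omega> A} \<le> exp (- v n)"
    if "1 \<le> n" and A: "A = A1 n \<or> A = A2 n" for n A
  proof -
    have "prob {\<omega> \<in> space M. ennreal (exp (- 4 * v n)) \<le> ?I n \<omega> A}
        \<le> exp (- (K' * \<epsilon> n)\<^sup>2 / (8 * K1)) ^ n / sqrt (exp (- 4 * v n))"
    proof (rule restricted_likelihood_integral_tail[OF indep \<open>1 \<le> n\<close> dist kern prob_\<pi> _ p0 h h0])
      show "A \<in> sets (\<pi> n)" using A sets by auto
      show "(\<integral>\<^sup>+ x. ennreal ((h x)\<^sup>2 * q x) \<partial>lborel) \<le> ennreal K1" if "q \<in> A" for q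
      proof -
        have "m (2 * p) q \<le> ennreal K" using A that by (auto simp: A1_def A2_def)
        then show ?thesis
          using \<open>K \<le> K1\<close> order_trans ennreal_leI unfolding h2 m_def by blast
      qed
      show "(\<integral>\<^sup>+ x. ennreal ((h x)\<^sup>2 * p0 x) \<partial>lborel) \<le> ennreal K1"
        using mp0 \<open>K \<le> K1\<close> order_trans ennreal_leI unfolding h2 m_def by blast
      show "(\<forall>q\<in>A. (\<integral>\<^sup>+ x. ennreal (h x * q x) \<partial>lborel) + ennreal (K' * \<epsilon> n)
                 \<le> (\<integral>\<^sup>+ x. ennreal (h x * p0 x) \<partial>lborel)) \<or>
            (\<forall>q\<in>A. (\<integral>\<^sup>+ x. ennreal (h x * p0 x) \<partial>lborel) + ennreal (K' * \<epsilon> n)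
                 \<le> (\<integral>\<^sup>+ x. ennreal (h x * q x) \<partial>lborel))"
        using A unfolding A1_def A2_def m_def h_def by blast
      show "0 < K' * \<epsilon> n" using \<open>0 < K'\<close> assms(8) by simp
    qed (use dens \<open>0 < K1\<close> space_\<pi> in auto)
    also have "(K' * \<epsilon> n)\<^sup>2 = 25 * K1 * (\<epsilon> n)\<^sup>2"
      using \<open>0 < K1\<close> by (simp add: K'_def power_mult_distrib)
    also have "exp (- (25 * K1 * (\<epsilon> n)\<^sup>2) / (8 * K1)) ^ n = exp (- (25 / 8) * v n)"
      using \<open>0 < K1\<close> by (simp add: exp_of_nat_mult[symmetric] v_def)
    also have "sqrt (exp (- 4 * v n)) = exp (- 2 * v n)"
      by (rule real_sqrt_unique) (simp_all add: power2_eq_square flip: exp_add)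
    also have "exp (- (25 / 8) * v n) / exp (- 2 * v n) = exp (- (9 / 8) * v n)"
      by (simp flip: exp_diff)
    also have "\<dots> \<le> exp (- v n)"
      by (simp add: v_def)
    finally show ?thesis .
  qed
  \<comment> \<open>The exponent 3 is 2 from the likelihood ratios in the neighbourhood plus 1 from
    its prior mass.\<close>
  have den: "prob {\<omega> \<in> space M. ?T n \<omega> < ennreal (exp (- 3 * v n) / 2)} \<le> 2 / v n"
    if "1 \<le> n" and prior: "measure (\<pi> n) (KL_nbhd F p0 (\<epsilon> n)) \<ge> exp (- real n * (\<epsilon> n)\<^sup>2)" for n
  proof -
    interpret \<pi>: prob_space "\<pi> n" by (rule prob_\<pi>)
    let ?A = "KL_nbhd F p0 (\<epsilon> n)"
    \<comment> \<open>A nonmeasurable set has \<open>measure\<close> 0 by convention, so the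
      positive lower bound on the prior mass yields measurability of the neighbourhood.\<close>
    have "measure (\<pi> n) ?A \<noteq> 0" using prior exp_gt_zero by (metis not_le)
    then have A: "?A \<in> sets (\<pi> n)" using measure_notin_sets by blast
    have "v n > 0" using \<open>1 \<le> n\<close> assms(8)[of n] by (simp add: v_def)
    have "prob {\<omega> \<in> space M. ?T n \<omega> < ennreal (exp (- 3 * v n) / 2)}
        \<le> prob {\<omega> \<in> space M. ?T n \<omega> < ennreal (exp (- 2 * v n) * measure (\<pi> n) ?A / 2)}"
    proof (rule finite_measure_mono)
      have "exp (- 3 * v n) = exp (- 2 * v n) * exp (- real n * (\<epsilon> n)\<^sup>2)"
        by (simp add: v_def flip: exp_add)
      also have "\<dots> \<le> exp (- 2 * v n) * measure (\<pi> n) ?A"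
        using prior by (intro mult_left_mono) auto
      finally have "ennreal (exp (- 3 * v n) / 2) \<le> ennreal (exp (- 2 * v n) * measure (\<pi> n) ?A / 2)"
        by (intro ennreal_leI divide_right_mono) auto
      then show "{\<omega> \<in> space M. ?T n \<omega> < ennreal (exp (- 3 * v n) / 2)}
          \<subseteq> {\<omega> \<in> space M. ?T n \<omega> < ennreal (exp (- 2 * v n) * measure (\<pi> n) ?A / 2)}"
        by (blast intro: less_le_trans)
      show "{\<omega> \<in> space M. ?T n \<omega> < ennreal (exp (- 2 * v n) * measure (\<pi> n) ?A / 2)} \<in> events"
        using Tm[of n] by measurable
    qed
    also have "\<dots> \<le> 2 * (1 / v n)"
    proof (rule integral_lower_tail[OF Wm _ A])
      fix q assume "q \<in> ?A"
      then have q: "q \<in> F"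
        and kl: "ext_integral (law_of p0) (\<lambda>x. log_ratio (p0 x) (q x)) \<le> ereal ((\<epsilon> n)\<^sup>2)"
          "ext_integral (law_of p0) (\<lambda>x. (log_ratio (p0 x) (q x))\<^sup>2) \<le> ereal ((\<epsilon> n)\<^sup>2)"
        by (simp_all add: KL_nbhd_def)
      have "0 < (\<epsilon> n)\<^sup>2"
        using assms(8)[of n] by simp
      from likelihood_ratio_lower_tail[OF indep \<open>1 \<le> n\<close> dist[of _ n] p0 dens[OF q] this kl]
      show "prob {\<omega> \<in> space M. ?W n \<omega> q < exp (- 2 * v n)} \<le> 1 / v n"
        by (simp add: v_def mult.assoc)
    qed (use \<open>v n > 0\<close> in \<open>auto intro: \<pi>.finite_measure_axioms\<close>)
    finally show ?thesis by simp
  qed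
  have "tendsto_in_prob M (\<lambda>n \<omega>. posterior (\<pi> n) p0 n (\<lambda>i. X i \<omega>) (B n)) 0"
    unfolding tendsto_in_prob_def
  proof (intro allI impI)
    fix \<eta> :: real assume "0 < \<eta>"
    let ?pc = "\<lambda>n. prob {\<omega> \<in> space M. \<eta> / 2 < \<bar>posterior (\<pi> n) p0 n (\<lambda>i. X i \<omega>) C - 0\<bar>}"
    have pc: "?pc \<longlonglongrightarrow> 0"
      using assms(13) half_gt_zero[OF \<open>0 < \<eta>\<close>] unfolding tendsto_in_prob_def C_def by blast
    have lim_exp: "(\<lambda>n. exp (- v n)) \<longlonglongrightarrow> 0"
      by (rule filterlim_compose[OF exp_at_bot]) (use v in \<open>simp add: filterlim_uminus_at_top\<close>)
    have lim_inv: "(\<lambda>n. 2 / v n) \<longlonglongrightarrow> 0"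
      by (rule tendsto_divide_0[OF tendsto_const]) (use v in \<open>simp add: filterlim_at_top_imp_at_infinity\<close>)
    \<comment> \<open>\<open>4 * exp (- v n)\<close> bounds the posterior share of
      \<open>A1 n\<close> and \<open>A2 n\<close> together: it is \<open>2 * exp (- 4 * v n)\<close>
      divided by \<open>exp (- 3 * v n) / 2\<close>.\<close>
    have "eventually (\<lambda>n. 4 * exp (- v n) < \<eta> / 2) sequentially"
      by (rule order_tendstoD(2)[OF tendsto_mult_right_zero[OF lim_exp]]) (use \<open>0 < \<eta>\<close> in simp)
    then have upper: "eventually (\<lambda>n. prob {\<omega> \<in> space M. \<eta> < \<bar>posterior (\<pi> n) p0 n (\<lambda>i. X i \<omega>) (B n) - 0\<bar>}
        \<le> ?pc n + 2 / v n + exp (- v n) + exp (- v n)) sequentially"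
      using assms(11) eventually_ge_at_top[of 1]
    proof eventually_elim
      case (elim n)
      \<comment> \<open>The exceptional events are a posterior mass of \<open>C\<close> above
        \<open>\<eta> / 2\<close>, a small denominator, and a large numerator over
        \<open>A1 n\<close> or \<open>A2 n\<close>. Off them \<open>C\<close> contributes at most
        \<open>\<eta> / 2\<close> to the posterior of \<open>B n\<close>, and the other two sets
        contribute less than \<open>\<eta> / 2\<close>.\<close>
      let ?E1 = "{\<omega> \<in> space M. \<eta> / 2 < \<bar>posterior (\<pi> n) p0 n (\<lambda>i. X i \<omega>) C - 0\<bar>}"
      let ?E2 = "{\<omega> \<in> space M. ?T n \<omega> < ennreal (exp (- 3 * v n) / 2)}"
      let ?E3 = "\<lambda>A. {\<omega> \<in> space M. ennreal (exp (- 4 * v n)) \<le> ?I n \<omega> A}"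
      have ev: "?E1 \<in> events" "?E2 \<in> events" "?E3 (A1 n) \<in> events" "?E3 (A2 n) \<in> events"
      proof -
        note [measurable] = Tm[of n] Im[OF sets(1), of n] Im[OF sets(2), of n] Im[OF sets(3), of n]
        show "?E1 \<in> events" unfolding posterior_def by measurable
        show "?E2 \<in> events" "?E3 (A1 n) \<in> events" "?E3 (A2 n) \<in> events" by measurable
      qed
      have "{\<omega> \<in> space M. \<eta> < \<bar>posterior (\<pi> n) p0 n (\<lambda>i. X i \<omega>) (B n) - 0\<bar>}
          \<subseteq> ?E1 \<union> ?E2 \<union> ?E3 (A1 n) \<union> ?E3 (A2 n)"
      proof (rule subsetI, rule ccontr)
        fix \<omega> assume *: "\<omega> \<in> {\<omega> \<in> space M. \<eta> < \<bar>posterior (\<pi> n) p0 n (\<lambda>i. X i \<omega>) (B n) - 0\<bar>}"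
          and not: "\<omega> \<notin> ?E1 \<union> ?E2 \<union> ?E3 (A1 n) \<union> ?E3 (A2 n)"
        then have \<omega>: "\<omega> \<in> space M" by simp
        have "posterior (\<pi> n) p0 n (\<lambda>i. X i \<omega>) (B n)
            \<le> posterior (\<pi> n) p0 n (\<lambda>i. X i \<omega>) C + 2 * exp (- 4 * v n) / (exp (- 3 * v n) / 2)"
          by (rule posterior_le[OF Wq[OF \<omega>] sets sub]) (use not \<omega> in \<open>auto simp: not_le not_less\<close>)
        also have "2 * exp (- 4 * v n) / (exp (- 3 * v n) / 2) = 4 * exp (- v n)"
        proof -
          have "exp (- 4 * v n) = exp (- 3 * v n) * exp (- v n)"
            by (simp flip: exp_add)
          then show ?thesis by simp
        qed
        also have "posterior (\<pi> n) p0 n (\<lambda>i. X i \<omega>) C \<le> \<eta> / 2"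
          using not \<omega> by auto
        finally have "posterior (\<pi> n) p0 n (\<lambda>i. X i \<omega>) (B n) < \<eta>"
          using elim(1) by simp
        moreover have "0 \<le> posterior (\<pi> n) p0 n (\<lambda>i. X i \<omega>) (B n)"
          by (simp add: posterior_def)
        ultimately show False using * by simp
      qed
      then have "prob {\<omega> \<in> space M. \<eta> < \<bar>posterior (\<pi> n) p0 n (\<lambda>i. X i \<omega>) (B n) - 0\<bar>}
          \<le> prob (?E1 \<union> ?E2 \<union> ?E3 (A1 n) \<union> ?E3 (A2 n))"
        using ev by (intro finite_measure_mono) auto
      also have "\<dots> \<le> prob ?E1 + prob ?E2 + prob (?E3 (A1 n)) + prob (?E3 (A2 n))"
        using ev by (intro order_trans[OF measure_Un_le] add_right_mono) auto
      also have "\<dots> \<le> ?pc n + 2 / v n + exp (- v n) + exp (- v n)"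
        by (intro add_mono order_refl den num elim) auto
      finally show ?case .
    qed
    have "(\<lambda>n. ?pc n + 2 / v n + exp (- v n) + exp (- v n)) \<longlonglongrightarrow> 0 + 0 + 0 + 0"
      by (intro tendsto_add pc lim_exp lim_inv)
    then have lim: "(\<lambda>n. ?pc n + 2 / v n + exp (- v n) + exp (- v n)) \<longlonglongrightarrow> 0"
      by simp
    show "(\<lambda>n. prob {\<omega> \<in> space M. \<eta> < \<bar>posterior (\<pi> n) p0 n (\<lambda>i. X i \<omega>) (B n) - 0\<bar>}) \<longlonglongrightarrow> 0"
      by (rule tendsto_sandwich[OF _ upper tendsto_const lim]) simp
  qed
  then show ?thesis
    using \<open>0 < K'\<close> unfolding B_def by blast
qed

end
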